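(* Let $\mathcal{R}\subset I\times J$ be a relation between finite sets $I$ and $J$, and let $d\ge 0$ be an integer. There exists a polytope whose facets are indexed by $I$, whose vertices are indexed by $J$, and whose facet-vertex incidence is $\mathcal{R}$ (i.e. facet $i$ contains vertex $j$ iff $(i,j)\in\mathcal{R}$) if and only if both of the following hold: (a) the maxbiclique lattice of $\mathcal{R}$ (with $J$ as the lower part) is flag connected, of rank $d+1$, and diamond; (b) $\mathcal{R}$ has a filled $1$-incidence matrix of rank $d$. Moreover, for such $\mathcal{R}$, a real $I\times J$ matrix $M$ is the facet-vertex matrix of some centered type $\mathcal{R}$ polytope in $\mathbb{R}^d$ if and only if $M$ is a rank $d$ filled $1$-incidence matrix of $\mathcal{R}$; and two centered type $\mathcal{R}$ polytopes in $\mathbb{R}^d$ have the same facet-vertex matrix if and only if they differ by an invertible linear transformation of $\mathbb{R}^d$, so that these matrices parameterize the linear moduli space (centered realizations modulo invertible linear transformations) of type $\mathcal{R}$ polytopes.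
   Context: A relation $\mathcal{R}\subset I\times J$ is viewed as a bipartite graph with rows $I$ and columns $J$. A filled $x$-incidence matrix of $\mathcal{R}$ is a real $I\times J$ matrix $M$ with $[M]_{i,j}=x$ for $(i,j)\in\mathcal{R}$ and $[M]_{i,j}<x$ for $(i,j)\notin\mathcal{R}$. An induced biclique is a pair $(I_0,J_0)$ with $I_0\subset I$, $J_0\subset J$, $I_0\times J_0\subset\mathcal{R}$; a maxbiclique is an inclusion-maximal induced biclique. The maxbiclique lattice is the set of maxbicliques ordered by $(I_0,J_0)\le(I_1,J_1)$ iff $J_0\subset J_1$. A flag of a poset is a maximal totally ordered subset; a poset is graded if all flags have the same length, and its rank is that common length, counted so that a singleton poset has rank $0$ (i.e. number of elements of a flag minus one). The flag graph has a node for each flag and an edge between flags $\mathcal{F},\mathcal{F}'$ with $|\mathcal{F}\setminus\mathcal{F}'|=1$; the poset is flag connected if it is graded and its flag graph is connected. A poset is diamond if it is graded and every interval $[a,b]=\{c: a\le c\le b\}$ with $b$ of rank two more than $a$ has exactly 4 elements. A polytope is the convex hull of finitely many points. For a full-dimensional polytope $P\subset\mathbb{R}^d$ containing the origin in its interior (called centered), its covertices $h_i$ are the vertices of the polar $P^*=\{y:\langle y,x\rangle\le 1\ \forall x\in P\}$, so $P=\{x:\langle h_i,x\rangle\le 1\ \forall i\}$ with $h_i$ corresponding to facet $i$; with vertices $w_j$, the facet-vertex matrix $M$ of $P$ has entries $[M]_{i,j}=\langle h_i,w_j\rangle$ (rows indexed by facets, columns by vertices). A type $\mathcal{R}$ polytope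 is one with facets indexed by $I$, vertices indexed by $J$, and facet-vertex incidence $\mathcal{R}$.
   Formalization: In the first equivalence a third condition is added beside (a) and (b): no row of R is contained in another row and no column in another column. Without it the claim fails: I={1,2,3}, J={1,2}, R={(1,1),(2,2)}, d=1 satisfies (a) and (b), but a segment has only two facets. *)

theory Defs
  imports "HOL-Analysis.Analysis"
begin

section \<open>Finite posets: flags, rank, flag connectedness, the diamond property\<close>

text \<open>
  A poset is a carrier \<open>A\<close> with an order \<open>le\<close>. The notions below are meant for finite posets.
\<close>

abbreviation is_flag :: "'p set \<Rightarrow> ('p \<Rightarrow> 'p \<Rightarrow> bool) \<Rightarrow> 'p set \<Rightarrow> bool" where
  "is_flag A le \<equiv> pred_on.maxchain A le"

definition graded :: "'p set \<Rightarrow> ('p \<Rightarrow> 'p \<Rightarrow> bool) \<Rightarrow> bool" where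
  "graded A le \<longleftrightarrow> (\<exists>n. \<forall>\<F>. is_flag A le \<F> \<longrightarrow> card \<F> = n)"

text \<open>Only meaningful for graded nonempty posets; a singleton has rank 0.\<close>

definition poset_rank :: "'p set \<Rightarrow> ('p \<Rightarrow> 'p \<Rightarrow> bool) \<Rightarrow> nat" where
  "poset_rank A le = (THE n. \<forall>\<F>. is_flag A le \<F> \<longrightarrow> card \<F> = Suc n)"

definition elem_rank :: "'p set \<Rightarrow> ('p \<Rightarrow> 'p \<Rightarrow> bool) \<Rightarrow> 'p \<Rightarrow> nat" where
  "elem_rank A le a = poset_rank {c \<in> A. le c a} le"

definition flag_adjacent :: "'p set \<Rightarrow> ('p \<Rightarrow> 'p \<Rightarrow> bool) \<Rightarrow> 'p set \<Rightarrow> 'p set \<Rightarrow> bool" where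
  "flag_adjacent A le \<F> \<G> \<longleftrightarrow> is_flag A le \<F> \<and> is_flag A le \<G> \<and> card (\<F> - \<G>) = 1"

definition flag_connected :: "'p set \<Rightarrow> ('p \<Rightarrow> 'p \<Rightarrow> bool) \<Rightarrow> bool" where
  "flag_connected A le \<longleftrightarrow> graded A le \<and>
     (\<forall>\<F> \<G>. is_flag A le \<F> \<and> is_flag A le \<G> \<longrightarrow> (flag_adjacent A le)\<^sup>*\<^sup>* \<F> \<G>)"

definition diamond :: "'p set \<Rightarrow> ('p \<Rightarrow> 'p \<Rightarrow> bool) \<Rightarrow> bool" where
  "diamond A le \<longleftrightarrow> graded A le \<and>
     (\<forall>a\<in>A. \<forall>b\<in>A. le a b \<and> elem_rank A le b = elem_rank A le a + 2 \<longrightarrow>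
        card {c \<in> A. le a c \<and> le c b} = 4)"


section \<open>Relations, maxbicliques, incidence matrices\<close>

definition biclique :: "'i set \<Rightarrow> 'j set \<Rightarrow> ('i \<times> 'j) set \<Rightarrow> 'i set \<times> 'j set \<Rightarrow> bool" where
  "biclique I J R B \<longleftrightarrow> fst B \<subseteq> I \<and> snd B \<subseteq> J \<and> fst B \<times> snd B \<subseteq> R"

definition maxbicliques :: "'i set \<Rightarrow> 'j set \<Rightarrow> ('i \<times> 'j) set \<Rightarrow> ('i set \<times> 'j set) set" where
  "maxbicliques I J R = {B. biclique I J R B \<and>
     (\<forall>C. biclique I J R C \<and> fst B \<subseteq> fst C \<and> snd B \<subseteq> snd C \<longrightarrow> C = B)}"

definition maxbiclique_le :: "'i set \<times> 'j set \<Rightarrow> 'i set \<times> 'j set \<Rightarrow> bool" where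
  "maxbiclique_le B C \<longleftrightarrow> snd B \<subseteq> snd C"

text \<open>
  No row is contained in another row and no column in another column. For a graded maxbiclique
  lattice of positive rank this means that \<open>I\<close> and \<open>J\<close> label the coatoms and the atoms without
  repetition. The lattice alone does not see this: if \<open>R\<close> is the facet-vertex incidence of a
  polytope, adding a row of \<open>R\<close> without incidences (and a zero row to its matrix), or repeating
  a row, changes neither the lattice up to isomorphism nor the rank of the matrix, but the new
  row does not correspond to a further facet.
\<close>

definition irredundant :: "'i set \<Rightarrow> 'j set \<Rightarrow> ('i \<times> 'j) set \<Rightarrow> bool" where
  "irredundant I J R \<longleftrightarrow>
     (\<forall>i\<in>I. \<forall>i'\<in>I. R `` {i} \<subseteq> R `` {i'} \<longrightarrow> i = i') \<and>
     (\<forall>j\<in>J. \<forall>j'\<in>J. R\<inverse> `` {j} \<subseteq> R\<inverse> `` {j'} \<longrightarrow> j = j')"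

text \<open>
  An \<open>I \<times> J\<close> matrix is a matrix over the ambient finite index types that vanishes outside
  \<open>I \<times> J\<close>; the padding with zeros does not affect \<^const>\<open>rank\<close>. In this way \<open>I\<close> and \<open>J\<close> are
  arbitrary finite sets, possibly empty.
\<close>

definition matrices :: "'i::finite set \<Rightarrow> 'j::finite set \<Rightarrow> (real ^ 'j ^ 'i) set" where
  "matrices I J = {M. \<forall>i j. i \<notin> I \<or> j \<notin> J \<longrightarrow> M $ i $ j = 0}"

definition filled_incidence_matrix ::
    "real \<Rightarrow> 'i::finite set \<Rightarrow> 'j::finite set \<Rightarrow> ('i \<times> 'j) set \<Rightarrow> real ^ 'j ^ 'i \<Rightarrow> bool" where
  "filled_incidence_matrix x I J R M \<longleftrightarrow> M \<in> matrices I J \<and>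
     (\<forall>i\<in>I. \<forall>j\<in>J. ((i, j) \<in> R \<longrightarrow> M $ i $ j = x) \<and> ((i, j) \<notin> R \<longrightarrow> M $ i $ j < x))"


section \<open>Polytopes of a given type\<close>

text \<open>
  Unlike in \<^const>\<open>facet_of\<close>, the empty face counts as the facet of a 0-dimensional polytope.
  This is forced by the correspondence with covertices: the polar of a point is a point, whose
  only vertex \<open>0\<close> corresponds to the empty face. In positive dimension the notions agree.
\<close>

definition facets :: "'a::euclidean_space set \<Rightarrow> 'a set set" where
  "facets P = {F. F face_of P \<and> aff_dim F = aff_dim P - 1}"

lemma facets_eq_facet_of:
  assumes "aff_dim P > 0"
  shows "facets P = {F. F facet_of P}"
  using assms by (auto simp: facets_def facet_of_def)

definition vertices :: "'a::euclidean_space set \<Rightarrow> 'a set" where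
  "vertices P = {x. x extreme_point_of P}"

text \<open>
  A labelled polytope is a triple of a polytope, a labelling of its facets by \<open>I\<close> and a labelling
  of its vertices by \<open>J\<close>.
\<close>

type_synonym ('i, 'j, 'a) labelled_polytope = "'a set \<times> ('i \<Rightarrow> 'a set) \<times> ('j \<Rightarrow> 'a)"

definition type_polytopes ::
    "'i set \<Rightarrow> 'j set \<Rightarrow> ('i \<times> 'j) set \<Rightarrow> ('i, 'j, 'a::euclidean_space) labelled_polytope set" where
  "type_polytopes I J R = {(P, F, w). polytope P \<and>
     bij_betw F I (facets P) \<and> bij_betw w J (vertices P) \<and>
     (\<forall>i\<in>I. \<forall>j\<in>J. (i, j) \<in> R \<longleftrightarrow> w j \<in> F i)}"

text \<open>
  The role of \<open>\<real>\<^sup>d\<close> is played by a \<open>d\<close>-dimensional linear subspace \<open>V\<close> of a Euclidean space with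
  the induced inner product. The case \<open>V = UNIV\<close> gives all \<open>d \<ge> 1\<close>; subspaces are used because
  types of class \<^class>\<open>euclidean_space\<close> have positive dimension and \<open>d = 0\<close> is to be included.
\<close>

definition centered :: "'a::euclidean_space set \<Rightarrow> 'a set \<Rightarrow> bool" where
  "centered V P \<longleftrightarrow> polytope P \<and> affine hull P = V \<and> 0 \<in> rel_interior P"

definition polar :: "'a::euclidean_space set \<Rightarrow> 'a set \<Rightarrow> 'a set" where
  "polar V P = {y \<in> V. \<forall>x\<in>P. y \<bullet> x \<le> 1}"

definition covertex :: "'a::euclidean_space set \<Rightarrow> 'a set \<Rightarrow> 'a set \<Rightarrow> 'a" where
  "covertex V P F = (THE h. h \<in> vertices (polar V P) \<and> F = {x \<in> P. h \<bullet> x = 1})"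

definition facet_vertex_matrix ::
    "'a::euclidean_space set \<Rightarrow> 'i::finite set \<Rightarrow> 'j::finite set \<Rightarrow>
     ('i, 'j, 'a) labelled_polytope \<Rightarrow> real ^ 'j ^ 'i" where
  "facet_vertex_matrix V I J = (\<lambda>(P, F, w).
     \<chi> i j. if i \<in> I \<and> j \<in> J then covertex V P (F i) \<bullet> w j else 0)"

definition centered_type_polytopes ::
    "'a::euclidean_space set \<Rightarrow> 'i set \<Rightarrow> 'j set \<Rightarrow> ('i \<times> 'j) set \<Rightarrow>
     ('i, 'j, 'a) labelled_polytope set" where
  "centered_type_polytopes V I J R = {(P, F, w) \<in> type_polytopes I J R. centered V P}"

definition linearly_equivalent ::
    "'a::euclidean_space set \<Rightarrow> 'i set \<Rightarrow> 'j set \<Rightarrow>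
     ('i, 'j, 'a) labelled_polytope \<Rightarrow> ('i, 'j, 'a) labelled_polytope \<Rightarrow> bool" where
  "linearly_equivalent V I J = (\<lambda>(P, F, w) (P', F', w').
     \<exists>T. linear T \<and> bij_betw T V V \<and> T ` P = P' \<and>
       (\<forall>i\<in>I. T ` F i = F' i) \<and> (\<forall>j\<in>J. T (w j) = w' j))"

definition linear_equivalence ::
    "'a::euclidean_space set \<Rightarrow> 'i set \<Rightarrow> 'j set \<Rightarrow> ('i \<times> 'j) set \<Rightarrow>
     (('i, 'j, 'a) labelled_polytope \<times> ('i, 'j, 'a) labelled_polytope) set" where
  "linear_equivalence V I J R =
     {(Q, Q'). Q \<in> centered_type_polytopes V I J R \<and> Q' \<in> centered_type_polytopes V I J R \<and>
        linearly_equivalent V I J Q Q'}"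

definition linear_moduli_space ::
    "'a::euclidean_space set \<Rightarrow> 'i set \<Rightarrow> 'j set \<Rightarrow> ('i \<times> 'j) set \<Rightarrow>
     ('i, 'j, 'a) labelled_polytope set set" where
  "linear_moduli_space V I J R = centered_type_polytopes V I J R // linear_equivalence V I J R"

end

theory Submission
  imports Defs
begin

text \<open>
  The face lattice of a polytope is flag connected and diamond; for the flag connectedness one
  needs that any two facets are linked through ridges. Mapping a face to the facets containing it
  and the vertices contained in it identifies this lattice with the maxbiclique lattice.

  Conversely, a matrix of rank \<open>d\<close> factors as \<open>h\<^sub>i \<bullet> w\<^sub>j\<close> with \<open>h\<^sub>i\<close>, \<open>w\<^sub>j\<close> in \<open>V\<close>. Every maxbiclique
  gives a face of \<open>P = conv {w\<^sub>j}\<close> in a strictly monotone way, so the dimensions force every flag of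
  maxbicliques to be a flag of faces. Since both lattices are diamond, a flag of faces adjacent to
  a flag of maxbicliques also consists of maxbicliques. As the face lattice is flag connected,
  there are no further faces.

  A covertex is determined by its values on its facet, because a facet spans \<open>V\<close>. Hence the
  facet-vertex matrix is the Gram matrix of vertices and covertices, and it determines both
  up to a linear isomorphism.
\<close>

section \<open>Flags of finite posets\<close>

text \<open>The converse compares two diamond posets by counting in intervals, so both must measure
  rank alike. Equal flag lengths achieve this: a strictly increasing function with values in 0, ...,
  n is the rank as soon as all flags have n+1 elements. Dimension plus one is such a function on all
  faces, and also on the faces that come from maxbicliques, so the number 4 in both diamond
  conditions counts in the same intervals. A flag of faces has one member of each dimension -1, 0,
  ..., d, hence rank d+1. Since the empty face also counts as the facet of a point, every flag of a
  nonempty polytope is the polytope together with a flag of a facet, and the inductions on dimension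
  start at the empty polytope. The polytope built from a matrix is not assumed to contain the
  origin. Once it has no further faces, the inequalities h_i \<bullet> x \<le> 1 account for all of
  its facets, and they hold strictly at 0.\<close>

lemma chain_iff:
  "pred_on.chain A le C \<longleftrightarrow> C \<subseteq> A \<and> (\<forall>x\<in>C. \<forall>y\<in>C. x = y \<or> le x y \<or> le y x)"
  by (auto simp: pred_on.chain_def)

text \<open>Maximality can be tested with one-element extensions, as any larger chain supplies an
  element comparable with all of \<open>C\<close>. The case \<open>x = y\<close> comes from the
  reflexive closure built into \<open>pred_on.chain\<close>.\<close>

lemma is_flag_iff:
  "is_flag A le C \<longleftrightarrow> C \<subseteq> A \<and> (\<forall>x\<in>C. \<forall>y\<in>C. x = y \<or> le x y \<or> le y x) \<and>
     (\<forall>x\<in>A. (\<forall>y\<in>C. x = y \<or> le x y \<or> le y x) \<longrightarrow> x \<in> C)"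
  (is "?l \<longleftrightarrow> ?r")
proof
  assume l: ?l
  then have C: "pred_on.chain A le C" and max: "\<And>S. \<not> (pred_on.chain A le S \<and> C \<subset> S)"
    by (auto simp: pred_on.maxchain_def)
  have "x \<in> C" if "x \<in> A" "\<forall>y\<in>C. x = y \<or> le x y \<or> le y x" for x
  proof (rule ccontr)
    assume "x \<notin> C"
    moreover have "pred_on.chain A le (insert x C)"
      using C that by (auto simp: chain_iff)
    ultimately show False
      using max by blast
  qed
  with C show ?r
    by (auto simp: chain_iff)
next
  assume r: ?r
  have "\<not> C \<subset> S" if S: "pred_on.chain A le S" for S
  proof
    assume "C \<subset> S"
    then obtain x where x: "x \<in> S" "x \<notin> C" and "C \<subseteq> S"
      by blast
    then have "x \<in> A" "\<forall>y\<in>C. x = y \<or> le x y \<or> le y x"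
      using S unfolding chain_iff by auto
    then show False
      using r x by blast
  qed
  moreover have "pred_on.chain A le C"
    using r by (simp add: chain_iff)
  ultimately show ?l
    by (auto simp: pred_on.maxchain_def)
qed

lemma flag_subset: "is_flag A le C \<Longrightarrow> C \<subseteq> A"
  by (simp add: is_flag_iff)

lemma flag_comparable: "is_flag A le C \<Longrightarrow> x \<in> C \<Longrightarrow> y \<in> C \<Longrightarrow> x = y \<or> le x y \<or> le y x"
  by (simp add: is_flag_iff)

lemma flag_memI:
  "is_flag A le C \<Longrightarrow> x \<in> A \<Longrightarrow> (\<And>y. y \<in> C \<Longrightarrow> x = y \<or> le x y \<or> le y x) \<Longrightarrow> x \<in> C"
  by (simp add: is_flag_iff)

text \<open>Applied to \<open>{}\<close> for the existence of a flag and to \<open>{x}\<close> for a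
  flag through a given element.\<close>

lemma chain_imp_flag:
  assumes "finite A" "pred_on.chain A le C"
  obtains D where "is_flag A le D" "C \<subseteq> D"
proof -
  have "finite {D. pred_on.chain A le D}"
    by (rule finite_subset[of _ "Pow A"]) (use assms in \<open>auto simp: chain_iff\<close>)
  then obtain D where D: "pred_on.chain A le D" "C \<subseteq> D"
      and "\<forall>E\<in>{D. pred_on.chain A le D}. D \<subseteq> E \<longrightarrow> D = E"
    using finite_has_maximal2[of "{D. pred_on.chain A le D}" C] assms(2) by auto
  then have "is_flag A le D"
    by (auto simp: pred_on.maxchain_def)
  with D that show ?thesis by blast
qed

lemma poset_rank_eqI:
  assumes "finite A" "\<And>\<F>. is_flag A le \<F> \<Longrightarrow> card \<F> = Suc n"
  shows "poset_rank A le = n"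
proof -
  \<comment> \<open>The description in \<open>poset_rank\<close> is unique only because some flag
    exists.\<close>
  obtain D where "is_flag A le D"
    using chain_imp_flag[of A le "{}"] assms(1) by (auto simp: chain_iff)
  then show ?thesis
    unfolding poset_rank_def using assms(2) by (intro the_equality) auto
qed

lemma card_flag_if_poset_rank:
  assumes "finite A" "A \<noteq> {}" "graded A le" "poset_rank A le = n" "is_flag A le \<F>"
  shows "card \<F> = Suc n"
proof -
  obtain m where m: "\<And>\<F>. is_flag A le \<F> \<Longrightarrow> card \<F> = m"
    using assms(3) by (auto simp: graded_def)
  \<comment> \<open>A nonempty poset has no empty flag, so the common cardinality is a successor, as
    \<open>poset_rank\<close> presupposes.\<close>
  have "\<F> \<noteq> {}"
    using assms(2,5) by (auto simp: is_flag_iff)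
  moreover have "finite \<F>"
    using assms(1,5) by (auto simp: is_flag_iff intro: finite_subset)
  ultimately have "m \<noteq> 0"
    using m[OF assms(5)] by auto
  then obtain k where "m = Suc k"
    using not0_implies_Suc by blast
  then have "poset_rank A le = k"
    using poset_rank_eqI[OF assms(1)] m by blast
  then show ?thesis
    using assms(4) m[OF assms(5)] \<open>m = Suc k\<close> by simp
qed

subsection \<open>Isomorphic posets\<close>

text \<open>Carriers with explicit relations are needed because \<open>maxbiclique_le\<close>
  compares column sets only and is antisymmetric on maxbicliques, not on all pairs.\<close>

locale order_iso =
  fixes A :: "'p set" and leA :: "'p \<Rightarrow> 'p \<Rightarrow> bool"
    and B :: "'q set" and leB :: "'q \<Rightarrow> 'q \<Rightarrow> bool" and f :: "'p \<Rightarrow> 'q"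
  assumes bij: "bij_betw f A B"
    and le_iff: "\<And>x y. x \<in> A \<Longrightarrow> y \<in> A \<Longrightarrow> leB (f x) (f y) \<longleftrightarrow> leA x y"
begin

lemma inj: "inj_on f A"
  using bij by (simp add: bij_betw_def)

lemma image: "B = f ` A"
  using bij by (simp add: bij_betw_def)

lemma is_flag_image: "C \<subseteq> A \<Longrightarrow> is_flag B leB (f ` C) \<longleftrightarrow> is_flag A leA C"
proof -
  assume C: "C \<subseteq> A"
  have eq: "f x = f y \<longleftrightarrow> x = y" if "x \<in> A" "y \<in> A" for x y
    using that inj by (auto simp: inj_on_def)
  have comp: "(\<forall>y\<in>f ` C. f x = y \<or> leB (f x) y \<or> leB y (f x)) \<longleftrightarrow>
      (\<forall>y\<in>C. x = y \<or> leA x y \<or> leA y x)" if "x \<in> A" for x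
    using C that eq le_iff by (auto simp: subset_iff)
  have mem: "f x \<in> f ` C \<longleftrightarrow> x \<in> C" if "x \<in> A" for x
    using C that inj by (meson inj_on_image_mem_iff)
  have "(\<forall>x\<in>f ` C. \<forall>y\<in>f ` C. x = y \<or> leB x y \<or> leB y x) \<longleftrightarrow>
        (\<forall>x\<in>C. \<forall>y\<in>C. x = y \<or> leA x y \<or> leA y x)"
    using comp C by (simp add: subset_iff)
  moreover have "(\<forall>x\<in>B. (\<forall>y\<in>f ` C. x = y \<or> leB x y \<or> leB y x) \<longrightarrow> x \<in> f ` C) \<longleftrightarrow>
        (\<forall>x\<in>A. (\<forall>y\<in>C. x = y \<or> leA x y \<or> leA y x) \<longrightarrow> x \<in> C)"
    unfolding image using comp mem by simp
  moreover have "f ` C \<subseteq> B"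
    using C image by auto
  ultimately show ?thesis
    unfolding is_flag_iff using C by simp
qed

lemma flag_target_iff: "is_flag B leB D \<longleftrightarrow> (\<exists>C. is_flag A leA C \<and> D = f ` C)"
proof
  assume D: "is_flag B leB D"
  then have "D \<subseteq> f ` A"
    using image by (auto simp: is_flag_iff)
  then obtain C where "C \<subseteq> A" "D = f ` C"
    by (auto simp: subset_image_iff)
  then show "\<exists>C. is_flag A leA C \<and> D = f ` C"
    using D is_flag_image by blast
next
  assume "\<exists>C. is_flag A leA C \<and> D = f ` C"
  then show "is_flag B leB D"
    using is_flag_image flag_subset by blast
qed

lemma card_flag_image: "is_flag A leA C \<Longrightarrow> card (f ` C) = card C"
  using card_image inj_on_subset[OF inj flag_subset] by blast

text \<open>Both \<open>graded\<close> and \<open>poset_rank\<close> see the poset only through this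
  predicate of \<open>n\<close>, so they transfer by rewriting.\<close>

lemma all_flags_card_iff:
  "(\<forall>\<F>. is_flag B leB \<F> \<longrightarrow> card \<F> = n) \<longleftrightarrow> (\<forall>\<F>. is_flag A leA \<F> \<longrightarrow> card \<F> = n)"
  using flag_target_iff card_flag_image by metis

lemma graded_iff: "graded B leB \<longleftrightarrow> graded A leA"
  by (simp add: graded_def all_flags_card_iff)

lemma poset_rank_eq: "poset_rank B leB = poset_rank A leA"
  by (simp add: poset_rank_def all_flags_card_iff)

lemma elem_rank_eq:
  assumes "a \<in> A"
  shows "elem_rank B leB (f a) = elem_rank A leA a"
proof -
  have "bij_betw f {c \<in> A. leA c a} {c \<in> B. leB c (f a)}"
    using assms le_iff inj image by (auto simp: bij_betw_def inj_on_def)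
  then interpret down: order_iso "{c \<in> A. leA c a}" leA "{c \<in> B. leB c (f a)}" leB f
    by unfold_locales (auto simp: le_iff)
  show ?thesis
    by (simp add: elem_rank_def down.poset_rank_eq)
qed

lemma flag_connected_target:
  assumes "flag_connected A leA"
  shows "flag_connected B leB"
proof -
  have step: "flag_adjacent B leB (f ` C) (f ` D)" if "flag_adjacent A leA C D" for C D
  proof -
    have sub: "C \<subseteq> A" "D \<subseteq> A"
      using that flag_subset by (auto simp: flag_adjacent_def)
    then have "f ` C - f ` D = f ` (C - D)"
      using inj by (metis inj_on_image_set_diff Diff_subset order_trans)
    moreover have "card (f ` (C - D)) = card (C - D)"
      using sub inj by (meson Diff_subset card_image inj_on_subset order_trans)
    ultimately show ?thesis
      using that sub is_flag_image by (simp add: flag_adjacent_def)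
  qed
  have "(flag_adjacent B leB)\<^sup>*\<^sup>* (f ` C) (f ` D)" if "(flag_adjacent A leA)\<^sup>*\<^sup>* C D" for C D
    using that
  proof (induction rule: rtranclp_induct)
    case (step D E)
    then show ?case
      using \<open>\<And>C D. flag_adjacent A leA C D \<Longrightarrow> flag_adjacent B leB (f ` C) (f ` D)\<close>
      by (meson rtranclp.rtrancl_into_rtrancl)
  qed auto
  then show ?thesis
    using assms unfolding flag_connected_def graded_iff flag_target_iff by blast
qed

lemma diamond_target:
  assumes "diamond A leA"
  shows "diamond B leB"
  unfolding diamond_def
proof (intro conjI ballI impI)
  show "graded B leB"
    using assms by (simp add: diamond_def graded_iff)
next
  fix a' b'
  assume "a' \<in> B" "b' \<in> B" and h: "leB a' b' \<and> elem_rank B leB b' = elem_rank B leB a' + 2"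
  then obtain a b where ab: "a \<in> A" "b \<in> A" "a' = f a" "b' = f b"
    using image by auto
  then have "{c \<in> B. leB a' c \<and> leB c b'} = f ` {c \<in> A. leA a c \<and> leA c b}"
    using image le_iff by auto
  moreover have "inj_on f {c \<in> A. leA a c \<and> leA c b}"
    using inj by (auto simp: inj_on_def)
  ultimately show "card {c \<in> B. leB a' c \<and> leB c b'} = 4"
    using assms ab h elem_rank_eq le_iff by (simp add: diamond_def card_image)
qed

end


subsection \<open>Posets with a rank function\<close>

text \<open>Only strict monotonicity of \<open>r\<close> is assumed; that \<open>r\<close> is the
  rank follows when all flags have \<open>n + 1\<close> elements. In this way one \<open>r\<close>
  serves a poset and a subset of it.\<close>

locale ranked_poset =
  fixes A :: "'p::order set" and r :: "'p \<Rightarrow> nat" and n :: nat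
  assumes fin: "finite A"
    and rank_less: "\<And>x y. x \<in> A \<Longrightarrow> y \<in> A \<Longrightarrow> x < y \<Longrightarrow> r x < r y"
    and rank_le: "\<And>x. x \<in> A \<Longrightarrow> r x \<le> n"
begin

lemma chain_comparable:
  "pred_on.chain A (\<le>) C \<Longrightarrow> x \<in> C \<Longrightarrow> y \<in> C \<Longrightarrow> x \<le> y \<or> y \<le> x"
  by (force simp: chain_iff)

lemma chain_le_iff:
  assumes "pred_on.chain A (\<le>) C" "x \<in> C" "y \<in> C"
  shows "x \<le> y \<longleftrightarrow> r x \<le> r y"
proof -
  have "x \<in> A" "y \<in> A"
    using assms by (auto simp: chain_iff)
  moreover have "x < y \<or> y < x \<or> x = y"
    using chain_comparable[OF assms] by (auto simp: less_le)
  ultimately show ?thesis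
    using rank_less[of x y] rank_less[of y x] by auto
qed

lemma inj_on_chain: "pred_on.chain A (\<le>) C \<Longrightarrow> inj_on r C"
  by (intro inj_onI) (metis antisym chain_le_iff order_refl)

lemma card_chain_le: "pred_on.chain A (\<le>) C \<Longrightarrow> card C \<le> Suc n"
  using card_inj_on_le[of r C "{..n}"] inj_on_chain[of C] rank_le
  by (auto simp: chain_iff)

lemma rank_image_full:
  assumes "pred_on.chain A (\<le>) C" "card C = Suc n"
  shows "r ` C = {..n}"
proof (rule card_subset_eq)
  show "r ` C \<subseteq> {..n}"
    using assms rank_le by (auto simp: chain_iff)
  show "card (r ` C) = card {..n}"
    using assms inj_on_chain by (simp add: card_image)
qed simp

text \<open>A chain has at most one element of each rank, so \<open>n + 1\<close> elements leave no
  room for another.\<close>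

lemma full_chain_is_flag:
  assumes "pred_on.chain A (\<le>) C" "card C = Suc n"
  shows "is_flag A (\<le>) C"
  unfolding pred_on.maxchain_def
proof (intro conjI notI)
  assume "\<exists>S. pred_on.chain A (\<le>) S \<and> C \<subset> S"
  then obtain S where S: "pred_on.chain A (\<le>) S" "C \<subset> S"
    by blast
  then have "finite S"
    using fin by (auto simp: chain_iff intro: finite_subset)
  then show False
    using S assms card_chain_le[of S] psubset_card_mono[of S C] by simp
qed (fact assms)

lemma flag_is_chain: "is_flag A (\<le>) C \<Longrightarrow> pred_on.chain A (\<le>) C"
  by (simp add: pred_on.maxchain_def)

text \<open>A flag of the down set of \<open>x\<close> and the part above \<open>x\<close> of a flag through \<open>x\<close> form a flag.\<close>

lemma elem_rank_eq:
  assumes full: "\<And>C. is_flag A (\<le>) C \<Longrightarrow> card C = Suc n" and x: "x \<in> A"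
  shows "elem_rank A (\<le>) x = r x"
  unfolding elem_rank_def
proof (rule poset_rank_eqI)
  show "finite {c \<in> A. c \<le> x}"
    using fin by simp
next
  fix C assume C: "is_flag {c \<in> A. c \<le> x} (\<le>) C"
  obtain D where D: "is_flag A (\<le>) D" "x \<in> D"
    using chain_imp_flag[OF fin, of "(\<le>)" "{x}"] x by (auto simp: chain_iff)
  have "x \<in> C"
    using C x unfolding is_flag_iff by auto
  let ?E = "C \<union> {d \<in> D. x \<le> d}"
  have E: "is_flag A (\<le>) ?E"
    unfolding is_flag_iff
  proof (intro conjI ballI impI)
    show "?E \<subseteq> A"
      using C D by (auto simp: is_flag_iff)
  next
    fix a b assume ab: "a \<in> ?E" "b \<in> ?E"
    have "c \<le> x" if "c \<in> C" for c
      using C that by (auto simp: is_flag_iff)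
    moreover have "a \<le> b \<or> b \<le> a" if "a \<in> C" "b \<in> C"
      using C that by (force simp: is_flag_iff)
    moreover have "a \<le> b \<or> b \<le> a" if "a \<in> D" "b \<in> D"
      using that chain_comparable[OF flag_is_chain[OF D(1)]] by blast
    ultimately show "a = b \<or> a \<le> b \<or> b \<le> a"
      using ab by (auto dest: order_trans)
  next
    fix a assume a: "a \<in> A" and cmp: "\<forall>b\<in>?E. a = b \<or> a \<le> b \<or> b \<le> a"
    then have "a \<le> x \<or> x \<le> a"
      using \<open>x \<in> C\<close> by auto
    then show "a \<in> ?E"
    proof
      assume "a \<le> x"
      then show ?thesis
        using C a cmp unfolding is_flag_iff by simp
    next
      assume "x \<le> a"
      moreover have "d \<le> x \<or> x \<le> d" if "d \<in> D" for d
        using D that chain_comparable[OF flag_is_chain] by blast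
      ultimately have "a = d \<or> a \<le> d \<or> d \<le> a" if "d \<in> D" for d
        using that cmp by (blast intro: order_trans)
      then have "a \<in> D"
        using D(1) a unfolding is_flag_iff by blast
      then show ?thesis
        using \<open>x \<le> a\<close> by simp
    qed
  qed
  have chE: "pred_on.chain A (\<le>) ?E"
    using E by (rule flag_is_chain)
  have "r ` ?E = {..n}"
    using rank_image_full[OF chE] full[OF E] by simp
  \<comment> \<open>The flag \<open>?E\<close> attains every rank up to \<open>n\<close>. A member
    of rank at most \<open>r x\<close> lies below \<open>x\<close>, so the ranks up to
    \<open>r x\<close> must come from \<open>C\<close>.\<close>
  have "r ` C = {..r x}"
  proof (intro subset_antisym subsetI)
    fix k assume "k \<in> r ` C"
    then obtain c where c: "c \<in> C" "k = r c" by blast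
    then have "c \<le> x"
      using C by (auto simp: is_flag_iff)
    then show "k \<in> {..r x}"
      using c chain_le_iff[OF chE, of c x] \<open>x \<in> C\<close> by simp
  next
    fix k assume k: "k \<in> {..r x}"
    then have "k \<in> r ` ?E"
      using rank_le[OF x] unfolding \<open>r ` ?E = {..n}\<close> by simp
    then obtain e where e: "e \<in> ?E" "k = r e" by blast
    then have "e \<le> x"
      using k chain_le_iff[OF chE, of e x] \<open>x \<in> C\<close> by simp
    then have "e \<in> C"
      using e \<open>x \<in> C\<close> by auto
    then show "k \<in> r ` C"
      using e by blast
  qed
  moreover have "inj_on r C"
    by (rule inj_on_subset[OF inj_on_chain[OF chE]]) simp
  ultimately show "card C = Suc (r x)"
    using card_image[of r C] by simp
qed

text \<open>
  If \<open>B\<close> contains a flag \<open>C\<close> of \<open>A\<close>, the element replaced in an adjacent flag lies in a rank two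
  interval of \<open>A\<close> with end points in \<open>B\<close>. By the diamond properties all four elements of this
  interval belong to \<open>B\<close>. Hence all flags that can be reached from \<open>C\<close> are contained in \<open>B\<close>.
\<close>

lemma diamond_subset_eq:
  assumes full: "\<And>C. is_flag A (\<le>) C \<Longrightarrow> card C = Suc n"
    and conn: "flag_connected A (\<le>)" and dA: "diamond A (\<le>)"
    and bot: "\<And>x y. x \<in> A \<Longrightarrow> y \<in> A \<Longrightarrow> r x = 0 \<Longrightarrow> r y = 0 \<Longrightarrow> x = y"
    and top: "\<And>x y. x \<in> A \<Longrightarrow> y \<in> A \<Longrightarrow> r x = n \<Longrightarrow> r y = n \<Longrightarrow> x = y"
    and B: "B \<subseteq> A" and fullB: "\<And>C. is_flag B (\<le>) C \<Longrightarrow> card C = Suc n"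
    and dB: "diamond B (\<le>)"
  shows "B = A"
proof -
  interpret B: ranked_poset B r n
    using B fin rank_less rank_le by unfold_locales (auto intro: finite_subset simp: subset_iff)
  have step: "D \<subseteq> B" if adj: "flag_adjacent A (\<le>) C D" and CB: "C \<subseteq> B" for C D
  proof -
    have C: "is_flag A (\<le>) C" and D: "is_flag A (\<le>) D"
      using adj by (auto simp: flag_adjacent_def)
    note cC = flag_is_chain[OF C] and cD = flag_is_chain[OF D]
    have sub: "C \<subseteq> A" "D \<subseteq> A"
      using cC cD by (auto simp: chain_iff)
    have fin': "finite C" "finite D"
      using sub fin finite_subset by blast+
    \<comment> \<open>Adjacency is symmetric because all flags have equal size.\<close>
    have "card (D - C) = 1"
    proof -
      have "card C = card (C \<inter> D) + card (C - D)"
        using fin'(1) by (rule card_Int_Diff)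
      moreover have "card D = card (D \<inter> C) + card (D - C)"
        using fin'(2) by (rule card_Int_Diff)
      moreover have "C \<inter> D = D \<inter> C" by blast
      ultimately show ?thesis
        using adj full[OF C] full[OF D] by (simp add: flag_adjacent_def)
    qed
    then obtain y where y: "D - C = {y}"
      by (auto simp: card_1_singleton_iff)
    obtain x where x: "C - D = {x}"
      using adj by (auto simp: flag_adjacent_def card_1_singleton_iff)
    have imC: "r ` C = {..n}" and imD: "r ` D = {..n}"
      using rank_image_full cC cD full C D by auto
    \<comment> \<open>Both flags take every rank exactly once, so the new element must fill the rank
      that was vacated.\<close>
    have xy: "r y = r x"
    proof -
      have "r y \<in> r ` C"
        using imC imD y by blast
      then obtain c where c: "c \<in> C" "r c = r y" by force
      have "c \<notin> D"
        using c y inj_on_chain[OF cD] by (metis DiffE inj_onD insertI1)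
      then have "c = x"
        using c x by blast
      then show ?thesis
        using c by simp
    qed
    have inA: "x \<in> A" "y \<in> A" "x \<noteq> y"
      using x y sub by auto
    \<comment> \<open>The elements of extreme rank are unique and cannot be exchanged. Hence
      \<open>x\<close> has neighbours \<open>a\<close> and \<open>b\<close> in the flag, and these
      survive in \<open>D\<close>.\<close>
    have "r x \<noteq> 0" "r x \<noteq> n"
      using bot[of x y] top[of x y] inA xy by auto
    then have rx: "0 < r x" "r x < n"
      using rank_le[of x] inA by auto
    obtain a where a: "a \<in> C" "r a = r x - 1"
      using imC rx by (metis (no_types, lifting) atMost_iff diff_le_self image_iff
          le_trans less_imp_le_nat)
    obtain b where b: "b \<in> C" "r b = r x + 1"
      using imC rx by (metis (no_types, lifting) Suc_eq_plus1 Suc_leI atMost_iff image_iff)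
    have "a \<noteq> x" "b \<noteq> x"
      using a b rx by auto
    then have abD: "a \<in> D" "b \<in> D"
      using a b x by blast+
    have "y \<in> D"
      using y by blast
    then have "a \<le> y" "y \<le> b"
      using chain_le_iff[OF cD] abD a b xy by auto
    have ab: "a \<le> b"
      using chain_le_iff[OF cC] a b by auto
    have abB: "a \<in> B" "b \<in> B"
      using a b CB by auto
    have "a \<in> A" "b \<in> A" "r b = r a + 2"
      using a b abB B rx by auto
    \<comment> \<open>Element ranks are given by \<open>r\<close> in both posets, so both diamond
      properties apply to the same pair \<open>a\<close>, \<open>b\<close>.\<close>
    then have "card {c \<in> A. a \<le> c \<and> c \<le> b} = 4"
      using dA elem_rank_eq[OF full] ab by (simp add: diamond_def)
    moreover have "card {c \<in> B. a \<le> c \<and> c \<le> b} = 4"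
      using dB B.elem_rank_eq[OF fullB] \<open>r b = r a + 2\<close> ab abB by (simp add: diamond_def)
    ultimately have "{c \<in> B. a \<le> c \<and> c \<le> b} = {c \<in> A. a \<le> c \<and> c \<le> b}"
      using B fin by (intro card_subset_eq) auto
    then have "y \<in> B"
      using inA \<open>a \<le> y\<close> \<open>y \<le> b\<close> by blast
    moreover have "D \<subseteq> insert y C"
      using y by auto
    ultimately show "D \<subseteq> B"
      using CB by blast
  qed
  have reach: "D \<subseteq> B" if "(flag_adjacent A (\<le>))\<^sup>*\<^sup>* C D" "C \<subseteq> B" for C D
    using that by (induction rule: rtranclp_induct) (auto dest: step)
  obtain C where C: "is_flag B (\<le>) C"
    using chain_imp_flag[OF B.fin, of "(\<le>)" "{}"] by (auto simp: chain_iff)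
  then have CB: "C \<subseteq> B"
    by (auto simp: is_flag_iff)
  have "pred_on.chain A (\<le>) C"
    using B.flag_is_chain[OF C] B by (auto simp: chain_iff)
  \<comment> \<open>The starting point of the walk: a flag of \<open>B\<close> already has the full
    length.\<close>
  then have fC: "is_flag A (\<le>) C"
    using full_chain_is_flag fullB[OF C] by blast
  have "x \<in> B" if x: "x \<in> A" for x
  proof -
    obtain D where "is_flag A (\<le>) D" "x \<in> D"
      using chain_imp_flag[OF fin, of "(\<le>)" "{x}"] x by (auto simp: chain_iff)
    then show ?thesis
      using conn fC reach CB unfolding flag_connected_def by blast
  qed
  then show ?thesis
    using B by blast
qed

end


section \<open>The face lattice of a polytope\<close>

abbreviation faces :: "'a::euclidean_space set \<Rightarrow> 'a set set" where
  "faces P \<equiv> {F. F face_of P}"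

lemma face_of_facet: "F \<in> facets P \<Longrightarrow> F face_of P"
  by (simp add: facets_def)

lemma aff_dim_facet: "F \<in> facets P \<Longrightarrow> aff_dim F = aff_dim P - 1"
  by (simp add: facets_def)

lemma facet_neq: "F \<in> facets P \<Longrightarrow> F \<noteq> P"
  by (auto simp: facets_def)

lemma finite_facets: "polytope P \<Longrightarrow> finite (facets P)"
  by (rule finite_subset[OF _ finite_polytope_faces[of P]]) (auto simp: facets_def)

lemma aff_dim_face_psubset:
  assumes "X face_of P" "Y face_of P" "X \<subset> Y"
  shows "aff_dim X < aff_dim Y"
proof (rule face_of_aff_dim_lt)
  show "convex Y"
    using assms(2) by (rule face_of_imp_convex)
  show "X face_of Y"
    using assms face_of_subset face_of_imp_subset by blast
qed (use assms in auto)

lemma facet_subset_eq: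
  assumes "G \<in> facets P" "H \<in> facets P" "G \<subseteq> H"
  shows "G = H"
  using aff_dim_face_psubset[of G P H] assms by (force simp: facets_def)

lemma proper_face_subset_facet:
  assumes "polytope P" "X face_of P" "X \<noteq> P"
  obtains F where "F \<in> facets P" "X \<subseteq> F"
proof (cases "X = {}")
  case False
  then obtain F where "F facet_of P" "X \<subseteq> F"
    using face_of_polyhedron_subset_facet assms polytope_imp_polyhedron by metis
  with that show ?thesis
    by (auto simp: facets_def facet_of_def)
next
  case True
  then have "P \<noteq> {}"
    using assms by simp
  then have "aff_dim P \<ge> 0"
    by (metis aff_dim_negative_iff not_le)
  show ?thesis
  proof (cases "aff_dim P = 0")
    case True
    \<comment> \<open>A point has the empty face, of dimension -1, as its facet.\<close>
    then have "{} \<in> facets P"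
      by (simp add: facets_def)
    with that \<open>X = {}\<close> show ?thesis by blast
  next
    case False
    then obtain F where "F facet_of P"
      using polytope_facet_exists assms \<open>aff_dim P \<ge> 0\<close> by (metis less_le)
    with that \<open>X = {}\<close> show ?thesis
      by (auto simp: facets_def facet_of_def)
  qed
qed

lemma nonempty_face_Inter_facets:
  assumes "polytope P" "X face_of P" "X \<noteq> {}"
    and x: "x \<in> P" "\<And>F. F \<in> facets P \<Longrightarrow> X \<subseteq> F \<Longrightarrow> x \<in> F"
  shows "x \<in> X"
proof (cases "X = P")
  case True
  then show ?thesis
    using x by simp
next
  case False
  then have "X = \<Inter>{F. F facet_of P \<and> X \<subseteq> F}"
    using face_of_polyhedron[OF polytope_imp_polyhedron] assms by blast
  moreover have "F facet_of P \<longleftrightarrow> F \<in> facets P" if "X \<subseteq> F" for F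
    using assms(3) that by (auto simp: facets_def facet_of_def)
  ultimately show ?thesis
    using x(2) by (metis (no_types, lifting) Inter_iff mem_Collect_eq)
qed

text \<open>The new case is the empty face. A point \<open>v\<close> in all facets would lie in
  every face \<open>{x}\<close> given by a vertex, so \<open>P = {v}\<close>; but then the empty
  face is a facet that misses \<open>v\<close>.\<close>

lemma face_Inter_facets:
  assumes "polytope P" "X face_of P"
    and v: "v \<in> P" "\<And>F. F \<in> facets P \<Longrightarrow> X \<subseteq> F \<Longrightarrow> v \<in> F"
  shows "v \<in> X"
proof (cases "X = {}")
  case False
  then show ?thesis
    using nonempty_face_Inter_facets assms by blast
next
  case True
  have False
  proof -
    have sing: "x = v" if "x extreme_point_of P" for x
    proof -
      have "{x} face_of P"
        using that by (simp add: face_of_singleton)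
      then show ?thesis
        using nonempty_face_Inter_facets[OF assms(1), of "{x}" v] v True by blast
    qed
    have "P = convex hull {x. x extreme_point_of P}"
      using assms(1) by (simp add: Krein_Milman_Minkowski polytope_imp_compact polytope_imp_convex)
    also have "\<dots> \<subseteq> convex hull {v}"
      using sing by (intro hull_mono) blast
    finally have "P = {v}"
      using v(1) by auto
    then have "{} \<in> facets P"
      by (simp add: facets_def)
    then show False
      using v(2) True by blast
  qed
  then show ?thesis ..
qed

lemma face_functional:
  fixes P :: "'a::euclidean_space set"
  assumes "polytope P" "F face_of P"
  obtains a b where "\<And>x. x \<in> P \<Longrightarrow> a \<bullet> x \<le> b" "\<And>x. x \<in> P \<Longrightarrow> a \<bullet> x = b \<longleftrightarrow> x \<in> F"
proof -
  have "F exposed_face_of P"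
    using assms by (simp add: exposed_face_of_polyhedron polytope_imp_polyhedron)
  then obtain a b where "P \<subseteq> {x. a \<bullet> x \<le> b}" "F = P \<inter> {x. a \<bullet> x = b}"
    by (auto simp: exposed_face_of_def)
  then show ?thesis
    by (intro that[of a b]) auto
qed


subsection \<open>The diamond property\<close>

text \<open>Between the dimensions of \<open>X\<close> and \<open>G\<close> there is no room for a
  further face.\<close>

lemma facets_Int_ridge:
  assumes "polytope P" "X face_of P" "aff_dim P = aff_dim X + 2"
    and "G \<in> facets P" "H \<in> facets P" "G \<noteq> H" "X \<subseteq> G" "X \<subseteq> H"
  shows "G \<inter> H = X"
proof (rule ccontr)
  assume ne: "G \<inter> H \<noteq> X"
  have face: "G \<inter> H face_of P"
    using assms by (intro face_of_Int) (auto simp: facets_def)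
  have "aff_dim X < aff_dim (G \<inter> H)"
    using aff_dim_face_psubset[OF assms(2) face] ne assms by blast
  moreover have "G \<inter> H \<noteq> G"
    using facet_subset_eq[OF assms(4,5)] assms(6) by blast
  then have "aff_dim (G \<inter> H) < aff_dim G"
    using aff_dim_face_psubset[OF face face_of_facet[OF assms(4)]] by blast
  ultimately show False
    using aff_dim_facet[OF assms(4)] assms(3) by simp
qed

text \<open>
  With slack functions \<open>s\<^sub>i = b\<^sub>i - a\<^sub>i \<bullet> x\<close> of the three facets and \<open>p\<^sub>i \<in> G\<^sub>i - X\<close>, a combination
  \<open>s\<^sub>3 - \<alpha> s\<^sub>1 - \<beta> s\<^sub>2\<close> with \<open>\<alpha>, \<beta> > 0\<close> vanishes on \<open>X\<close>, \<open>p\<^sub>1\<close>, \<open>p\<^sub>2\<close> and hence on \<open>P\<close>, but it is negative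
  at \<open>p\<^sub>3\<close>.
\<close>

lemma no_three_facets_through_ridge:
  assumes P: "polytope P" and X: "X face_of P" "aff_dim P = aff_dim X + 2"
    and G: "G1 \<in> facets P" "G2 \<in> facets P" "G3 \<in> facets P"
    and ne: "G1 \<noteq> G2" "G1 \<noteq> G3" "G2 \<noteq> G3"
    and sub: "X \<subseteq> G1" "X \<subseteq> G2" "X \<subseteq> G3"
  shows False
proof -
  have cP: "convex P"
    using P by (rule polytope_imp_convex)
  have "\<exists>p. p \<in> G \<and> p \<notin> X" if "G \<in> facets P" "X \<subseteq> G" for G
  proof -
    have "G \<noteq> X"
      using that X(2) aff_dim_facet[of G P] by auto
    then show ?thesis
      using that by blast
  qed
  then obtain p1 p2 p3 where p: "p1 \<in> G1" "p1 \<notin> X" "p2 \<in> G2" "p2 \<notin> X" "p3 \<in> G3" "p3 \<notin> X"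
    using G sub by metis
  have pP: "p1 \<in> P" "p2 \<in> P" "p3 \<in> P"
    using p G face_of_facet face_of_imp_subset by blast+
  have XP: "X \<subseteq> P"
    using X(1) by (rule face_of_imp_subset)
  have "G1 \<inter> G2 = X" "G1 \<inter> G3 = X" "G2 \<inter> G3 = X"
    using facets_Int_ridge[OF P X] G ne sub by auto
  then have notin: "p1 \<notin> G2" "p1 \<notin> G3" "p2 \<notin> G1" "p2 \<notin> G3" "p3 \<notin> G1" "p3 \<notin> G2"
    using p by blast+
  obtain a1 b1 where 1: "\<And>x. x \<in> P \<Longrightarrow> a1 \<bullet> x \<le> b1" "\<And>x. x \<in> P \<Longrightarrow> a1 \<bullet> x = b1 \<longleftrightarrow> x \<in> G1"
    using face_functional[OF P face_of_facet[OF G(1)]] by blast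
  obtain a2 b2 where 2: "\<And>x. x \<in> P \<Longrightarrow> a2 \<bullet> x \<le> b2" "\<And>x. x \<in> P \<Longrightarrow> a2 \<bullet> x = b2 \<longleftrightarrow> x \<in> G2"
    using face_functional[OF P face_of_facet[OF G(2)]] by blast
  obtain a3 b3 where 3: "\<And>x. x \<in> P \<Longrightarrow> a3 \<bullet> x \<le> b3" "\<And>x. x \<in> P \<Longrightarrow> a3 \<bullet> x = b3 \<longleftrightarrow> x \<in> G3"
    using face_functional[OF P face_of_facet[OF G(3)]] by blast
  have pos: "a1 \<bullet> p2 < b1" "a1 \<bullet> p3 < b1" "a2 \<bullet> p1 < b2" "a2 \<bullet> p3 < b2" "a3 \<bullet> p1 < b3" "a3 \<bullet> p2 < b3"
    using 1 2 3 pP notin by (auto simp: less_le)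
  have zero: "a1 \<bullet> p1 = b1" "a2 \<bullet> p2 = b2" "a3 \<bullet> p3 = b3"
    using 1 2 3 pP p by auto
  have zeroX: "a1 \<bullet> x = b1" "a2 \<bullet> x = b2" "a3 \<bullet> x = b3" if "x \<in> X" for x
  proof -
    have "x \<in> P" "x \<in> G1" "x \<in> G2" "x \<in> G3"
      using that XP sub by auto
    then show "a1 \<bullet> x = b1" "a2 \<bullet> x = b2" "a3 \<bullet> x = b3"
      using 1(2)[of x] 2(2)[of x] 3(2)[of x] by auto
  qed
  \<comment> \<open>The second slack vanishes at \<open>p2\<close>, so vanishing of the combination
    at \<open>p2\<close> determines \<alpha>; likewise \<open>p1\<close> determines \<beta>.\<close>
  define \<alpha> where "\<alpha> = (b3 - a3 \<bullet> p2) / (b1 - a1 \<bullet> p2)"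
  define \<beta> where "\<beta> = (b3 - a3 \<bullet> p1) / (b2 - a2 \<bullet> p1)"
  have ab: "\<alpha> > 0" "\<beta> > 0"
    using pos by (auto simp: \<alpha>_def \<beta>_def)
  have \<alpha>: "\<alpha> * (b1 - a1 \<bullet> p2) = b3 - a3 \<bullet> p2" and \<beta>: "\<beta> * (b2 - a2 \<bullet> p1) = b3 - a3 \<bullet> p1"
    using pos by (auto simp: \<alpha>_def \<beta>_def)
  \<comment> \<open>Each of \<open>p1\<close> and \<open>p2\<close> raises the dimension of
    \<open>X\<close> by one, so \<open>H\<close> is the whole affine hull of \<open>P\<close> and
    contains \<open>p3\<close>.\<close>
  define H where "H = affine hull (insert p2 (insert p1 X))"
  have p1: "p1 \<notin> affine hull X"
    using face_of_imp_eq_affine_Int[OF cP X(1)] pP p by blast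
  have "affine hull (insert p1 X) \<subseteq> affine hull G1"
    using p sub by (intro hull_mono) blast
  then have p2: "p2 \<notin> affine hull (insert p1 X)"
    using face_of_imp_eq_affine_Int[OF cP face_of_facet[OF G(1)]] pP notin by blast
  have "aff_dim H = aff_dim P"
    unfolding H_def aff_dim_affine_hull aff_dim_insert using p1 p2 X(2) by simp
  moreover have "H \<subseteq> affine hull P"
    unfolding H_def using pP XP by (intro hull_mono) blast
  moreover have "H \<noteq> {}"
    by (simp add: H_def)
  ultimately have "H = affine hull P"
    using affine_dim_equal[of H "affine hull P"] by (simp add: H_def)
  then have "p3 \<in> H"
    using pP by (simp add: hull_inc)
  moreover have "H \<subseteq> {x. (a3 - \<alpha> *\<^sub>R a1 - \<beta> *\<^sub>R a2) \<bullet> x = b3 - \<alpha> * b1 - \<beta> * b2}"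
    unfolding H_def
  proof (rule hull_minimal)
    show "insert p2 (insert p1 X) \<subseteq> {x. (a3 - \<alpha> *\<^sub>R a1 - \<beta> *\<^sub>R a2) \<bullet> x = b3 - \<alpha> * b1 - \<beta> * b2}"
      using zero zeroX \<alpha> \<beta> by (auto simp: inner_diff_left algebra_simps)
  qed (rule affine_hyperplane)
  ultimately have "\<alpha> * (b1 - a1 \<bullet> p3) + \<beta> * (b2 - a2 \<bullet> p3) = 0"
    using zero by (auto simp: inner_diff_left algebra_simps)
  moreover have "\<alpha> * (b1 - a1 \<bullet> p3) > 0" "\<beta> * (b2 - a2 \<bullet> p3) > 0"
    using ab pos by auto
  ultimately show False by simp
qed

text \<open>A single facet through \<open>X\<close> would equal \<open>X\<close>, because a face is
  cut out by the facets containing it; three facets are excluded by the slack functions. The ridge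
  may be the empty face of a segment.\<close>

lemma facets_through_ridge:
  assumes P: "polytope P" and X: "X face_of P" "aff_dim P = aff_dim X + 2"
  obtains G H where "G \<noteq> H" "{F \<in> facets P. X \<subseteq> F} = {G, H}"
proof -
  have "X \<noteq> P"
    using X by auto
  then obtain G where G: "G \<in> facets P" "X \<subseteq> G"
    using proper_face_subset_facet P X by blast
  have "\<exists>H. H \<in> facets P \<and> X \<subseteq> H \<and> H \<noteq> G"
  proof (rule ccontr)
    assume "\<not> ?thesis"
    then have "x \<in> X" if "x \<in> G" for x
      using face_Inter_facets[OF P X(1), of x] G(1) that face_of_facet face_of_imp_subset by blast
    then have "X = G"
      using G(2) by blast
    then show False
      using aff_dim_facet[OF G(1)] X(2) by simp
  qed
  then obtain H where H: "H \<in> facets P" "X \<subseteq> H" "H \<noteq> G"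
    by blast
  have "F = G \<or> F = H" if "F \<in> facets P" "X \<subseteq> F" for F
    using no_three_facets_through_ridge[OF P X G(1) H(1) that(1)] G H that by blast
  then have "{F \<in> facets P. X \<subseteq> F} = {G, H}"
    using G H by blast
  with that H(3) show ?thesis by blast
qed

text \<open>An arbitrary interval of rank two reduces to this one by taking its upper face as the
  polytope.\<close>

lemma card_rank_two_interval:
  assumes P: "polytope P" and X: "X face_of P" "aff_dim P = aff_dim X + 2"
  shows "card {F. F face_of P \<and> X \<subseteq> F} = 4"
proof -
  obtain G H where GH: "G \<noteq> H" "{F \<in> facets P. X \<subseteq> F} = {G, H}"
    using facets_through_ridge[OF assms] by blast
  have "F = X \<or> F = P \<or> F \<in> facets P" if F: "F face_of P" "X \<subseteq> F" for F
  proof -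
    have "aff_dim X < aff_dim F" if "F \<noteq> X"
      using aff_dim_face_psubset[OF X(1) F(1)] F that by blast
    moreover have "aff_dim F < aff_dim P" if "F \<noteq> P"
      using face_of_aff_dim_lt[OF polytope_imp_convex[OF P] F(1)] that by blast
    ultimately show ?thesis
      using F X(2) unfolding facets_def by fastforce
  qed
  moreover have "P face_of P"
    using P by (simp add: face_of_refl polytope_imp_convex)
  ultimately have "{F. F face_of P \<and> X \<subseteq> F} = {X, P} \<union> {F \<in> facets P. X \<subseteq> F}"
    using X(1) face_of_imp_subset[OF X(1)] by (auto simp: face_of_facet)
  moreover have "G \<in> facets P" "H \<in> facets P"
    using GH by blast+
  then have "aff_dim G = aff_dim P - 1" "aff_dim H = aff_dim P - 1"
    by (simp_all add: aff_dim_facet)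
  then have "G \<noteq> P" "H \<noteq> P" "G \<noteq> X" "H \<noteq> X"
    using X(2) by auto
  moreover have "X \<noteq> P"
    using X(2) by auto
  ultimately show ?thesis
    using GH by simp
qed


subsection \<open>Connectedness of the facets through ridges\<close>

text \<open>A line that is not contained in an affine set meets it at most once. Hence on a segment
  from a point off the old sets to a point off the new one only finitely many parameters are
  bad.\<close>

lemma convex_avoid_finite_affine:
  fixes S :: "'a::real_vector set"
  assumes "finite \<T>" "convex S" "S \<noteq> {}"
    and "\<And>T. T \<in> \<T> \<Longrightarrow> affine T" "\<And>T. T \<in> \<T> \<Longrightarrow> \<not> S \<subseteq> T"
  obtains x where "x \<in> S" "\<And>T. T \<in> \<T> \<Longrightarrow> x \<notin> T"
proof -
  have "\<exists>x\<in>S. \<forall>T\<in>\<T>. x \<notin> T"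
    using assms
  proof (induction \<T>)
    case empty
    then show ?case by auto
  next
    case (insert T \<T>)
    then obtain x where x: "x \<in> S" "\<forall>T\<in>\<T>. x \<notin> T"
      by auto
    obtain y where y: "y \<in> S" "y \<notin> T"
      using insert.prems by blast
    show ?case
    proof (cases "x \<in> T")
      case False
      with x show ?thesis by blast
    next
      case True
      define z where "z t = (1 - t) *\<^sub>R x + t *\<^sub>R y" for t
      have "finite {t. z t \<in> U}" if U: "U \<in> \<T>" for U
      proof -
        have "s = t" if "z s \<in> U" "z t \<in> U" for s t
        proof (rule ccontr)
          assume "s \<noteq> t"
          \<comment> \<open>Extrapolation to parameter 0: with coefficients
            \<open>t * \<delta>\<close> and \<open>- (s * \<delta>)\<close> the point
            \<open>y\<close> cancels, and \<open>x\<close> becomes an affine combination of two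
            points of \<open>U\<close>.\<close>
          define \<delta> where "\<delta> = 1 / (t - s)"
          have \<delta>: "t * \<delta> - s * \<delta> = 1"
            using \<open>s \<noteq> t\<close> diff_divide_distrib[of t s "t - s"] by (simp add: \<delta>_def)
          have "(t * \<delta>) *\<^sub>R z s + (- (s * \<delta>)) *\<^sub>R z t = (t * \<delta> - s * \<delta>) *\<^sub>R x"
            by (simp add: z_def algebra_simps)
          then have "x \<in> U"
            using insert.prems(3)[of U] U that \<delta>
              mem_affine[of U "z s" "z t" "t * \<delta>" "- (s * \<delta>)"] by simp
          then show False
            using x U by blast
        qed
        then have "{t. z t \<in> U} \<subseteq> {SOME t. z t \<in> U}"
          by (metis (mono_tags, lifting) insertCI mem_Collect_eq someI_ex subsetI)
        then show ?thesis
          by (rule finite_subset) simp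
      qed
      then have "finite (\<Union>U\<in>\<T>. {t. z t \<in> U})"
        using insert.hyps by blast
      then have "infinite ({0<..<1} - (\<Union>U\<in>\<T>. {t. z t \<in> U}))"
        by (meson Diff_infinite_finite infinite_Ioo zero_less_one)
      then obtain t where "t \<in> {0<..<1} - (\<Union>U\<in>\<T>. {t. z t \<in> U})"
        using infinite_imp_nonempty by blast
      then have t: "0 < t" "t < 1" "\<forall>U\<in>\<T>. z t \<notin> U"
        by auto
      \<comment> \<open>Here \<open>x\<close> lies in \<open>T\<close>; a second point of the line
        in \<open>T\<close> would force \<open>y\<close> into \<open>T\<close>.\<close>
      have "z t \<notin> T"
      proof
        assume zt: "z t \<in> T"
        have "(1 / t) *\<^sub>R z t + (1 - 1 / t) *\<^sub>R x = ((1 / t) * (1 - t) + (1 - 1 / t)) *\<^sub>R x + y"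
          using t unfolding z_def scaleR_add_left scaleR_add_right scaleR_scaleR by simp
        also have "(1 / t) * (1 - t) + (1 - 1 / t) = 0"
          using t by (simp add: field_simps)
        finally have "y = (1 / t) *\<^sub>R z t + (1 - 1 / t) *\<^sub>R x"
          by simp
        then have "y \<in> T"
          using mem_affine[of T "z t" x "1 / t" "1 - 1 / t"] insert.prems(3)[of T] zt True by simp
        then show False
          using y by blast
      qed
      moreover have "z t \<in> S"
        unfolding z_def using insert.prems(1) x y t by (intro convexD) auto
      ultimately show ?thesis
        using t by blast
    qed
  qed
  with that show ?thesis by blast
qed

definition ridge_adjacent :: "'a::euclidean_space set \<Rightarrow> 'a set \<Rightarrow> 'a set \<Rightarrow> bool" where
  "ridge_adjacent P G H \<longleftrightarrow> G \<in> facets P \<and> H \<in> facets P \<and> aff_dim (G \<inter> H) = aff_dim P - 2"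

lemma aff_dim_facets_Int:
  assumes "G \<in> facets P" "H \<in> facets P" "G \<noteq> H"
  shows "aff_dim (G \<inter> H) \<le> aff_dim P - 2"
proof -
  have "G \<inter> H face_of P"
    using assms by (intro face_of_Int) (auto simp: facets_def)
  moreover have "G \<inter> H \<noteq> G"
    using facet_subset_eq[OF assms(1,2)] assms(3) by blast
  ultimately have "aff_dim (G \<inter> H) < aff_dim G"
    using aff_dim_face_psubset[of "G \<inter> H" P G] face_of_facet[OF assms(1)] by blast
  then show ?thesis
    using aff_dim_facet[OF assms(1)] by simp
qed


text \<open>
  From an interior point \<open>c\<close> the affine hull of \<open>P\<close> is the union of the closed cones over the facets. A
  segment from the cone of \<open>G0\<close> to the cone of \<open>H0\<close> in general position avoids the cones
  over intersections of facets of dimension less than that of a ridge, because they have codimension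
  at least 2. As the segment is connected, it can pass from cone to cone only through ridges.
\<close>

theorem facets_ridge_connected:
  assumes P: "polytope P" and G0: "G0 \<in> facets P" and H0: "H0 \<in> facets P"
  shows "(ridge_adjacent P)\<^sup>*\<^sup>* G0 H0"
proof (cases "aff_dim P \<le> 1")
  case True
  show ?thesis
  proof (cases "G0 = H0")
    case False
    \<comment> \<open>The left side is at least -1 and at most the right side, so in a segment the
      empty face is the ridge.\<close>
    then have "aff_dim (G0 \<inter> H0) = aff_dim P - 2"
      using aff_dim_facets_Int[OF G0 H0] aff_dim_geq[of "G0 \<inter> H0"] True by simp
    then show ?thesis
      using G0 H0 by (auto simp: ridge_adjacent_def)
  qed simp
next
  case False
  then have dim: "aff_dim P \<ge> 2" by simp
  then have "P \<noteq> {}" by auto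
  have cP: "convex P" and bP: "bounded P" and clP: "closed P"
    using P by (simp_all add: polytope_imp_convex polytope_imp_bounded polytope_imp_closed)
  obtain c where c: "c \<in> rel_interior P"
    using rel_interior_eq_empty[OF cP] \<open>P \<noteq> {}\<close> by auto
  then have cP': "c \<in> P"
    using rel_interior_subset by blast
  have "\<exists>a b. \<forall>x\<in>P. a \<bullet> x \<le> b \<and> (a \<bullet> x = b \<longleftrightarrow> x \<in> K)" if "K \<in> facets P" for K
    using face_functional[OF P face_of_facet[OF that]] by metis
  then obtain a b where ab: "\<And>K x. K \<in> facets P \<Longrightarrow> x \<in> P \<Longrightarrow> a K \<bullet> x \<le> b K"
      "\<And>K x. K \<in> facets P \<Longrightarrow> x \<in> P \<Longrightarrow> a K \<bullet> x = b K \<longleftrightarrow> x \<in> K"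
    by metis
  have cK: "c \<notin> K" if "K \<in> facets P" for K
    using face_of_disjoint_rel_interior[OF face_of_facet[OF that] facet_neq[OF that]] c by blast
  have pos: "0 < b K - a K \<bullet> c" if "K \<in> facets P" for K
    using ab[OF that cP'] cK[OF that] by auto
  \<comment> \<open>Normalised so that \<open>f K\<close> is 0 at \<open>c\<close>, 1 on
    \<open>K\<close> and at most 1 on \<open>P\<close>. The maximum over all facets is then the
    gauge of \<open>P\<close> about \<open>c\<close>, and \<open>cone K\<close> is the region where
    \<open>K\<close> attains it.\<close>
  define f where "f K z = (a K \<bullet> (z - c)) / (b K - a K \<bullet> c)" for K z
  have f_le: "f K x \<le> 1" and f_eq: "f K x = 1 \<longleftrightarrow> x \<in> K" if "K \<in> facets P" "x \<in> P" for K x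
    using ab[OF that] pos[OF that(1)] by (auto simp: f_def inner_diff_right field_simps)
  have f_scale: "f K (c + t *\<^sub>R (z - c)) = t * f K z" for K t z
    by (simp add: f_def)
  define cone where "cone K = {z. \<forall>L\<in>facets P. f L z \<le> f K z}" for K
  have closed_cone: "closed (cone K)" for K
  proof -
    have "cone K = (\<Inter>L\<in>facets P. {z. f L z \<le> f K z})"
      by (auto simp: cone_def)
    also have "closed \<dots>"
      unfolding f_def divide_inverse
      by (intro closed_INT ballI closed_Collect_le continuous_intros)
    finally show ?thesis .
  qed
  have facet_sub: "K \<subseteq> P" if "K \<in> facets P" for K
    using face_of_imp_subset[OF face_of_facet[OF that]] .
  have hull_cone: "convex hull (insert c K) \<subseteq> cone K" if K: "K \<in> facets P" for K
  proof
    fix z assume z: "z \<in> convex hull (insert c K)"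
    have "aff_dim K \<ge> 1"
      using aff_dim_facet[OF K] dim by simp
    then have "K \<noteq> {}" by auto
    moreover have "convex K"
      using face_of_imp_convex[OF face_of_facet[OF K]] .
    ultimately obtain u v k where uv: "u \<ge> 0" "v \<ge> 0" "u + v = 1" "k \<in> K" "z = u *\<^sub>R c + v *\<^sub>R k"
      using z by (auto simp: convex_hull_insert hull_same)
    then have "u = 1 - v"
      by simp
    then have zc: "z = c + v *\<^sub>R (k - c)"
      unfolding uv(5) \<open>u = 1 - v\<close> by (simp add: algebra_simps)
    have "f L z \<le> f K z" if L: "L \<in> facets P" for L
    proof -
      have "k \<in> P"
        using uv(4) facet_sub[OF K] by blast
      then have "f L k \<le> f K k"
        using f_le[OF L, of k] f_eq[OF K, of k] uv(4) by simp
      then show ?thesis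
        using uv(2) unfolding zc f_scale by (rule mult_left_mono)
    qed
    then show "z \<in> cone K"
      by (simp add: cone_def)
  qed
  \<comment> \<open>The singleton \<open>{c}\<close> is included because points of the segment will
    be projected from \<open>c\<close> to the frontier.\<close>
  define \<T> where "\<T> = insert {c} ((\<lambda>(K, L). affine hull (insert c (K \<inter> L))) `
      {(K, L). K \<in> facets P \<and> L \<in> facets P \<and> K \<noteq> L \<and> \<not> ridge_adjacent P K L})"
  have fin: "finite \<T>"
  proof -
    have "finite (facets P \<times> facets P)"
      using finite_facets[OF P] by simp
    then have "finite {(K, L). K \<in> facets P \<and> L \<in> facets P \<and> K \<noteq> L \<and> \<not> ridge_adjacent P K L}"
      by (rule finite_subset[rotated]) auto
    then show ?thesis
      by (simp add: \<T>_def)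
  qed
  have aff: "affine T" if "T \<in> \<T>" for T
    using that by (auto simp: \<T>_def)
  have dimT: "aff_dim T \<le> aff_dim P - 2" if T: "T \<in> \<T>" for T
  proof -
    have bound: "aff_dim (affine hull (insert c (K \<inter> L))) \<le> aff_dim P - 2"
      if "K \<in> facets P" "L \<in> facets P" "K \<noteq> L" "\<not> ridge_adjacent P K L" for K L
      using aff_dim_facets_Int[OF that(1-3)] that
      by (auto simp: aff_dim_affine_hull aff_dim_insert ridge_adjacent_def)
    consider "T = {c}" | K L where "K \<in> facets P" "L \<in> facets P" "K \<noteq> L"
        "\<not> ridge_adjacent P K L" "T = affine hull (insert c (K \<inter> L))"
      using T unfolding \<T>_def by auto
    then show ?thesis
      by cases (use dim bound in auto)
  qed
  have dim_hull: "aff_dim (convex hull (insert c K)) = aff_dim P" if K: "K \<in> facets P" for K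
  proof -
    have "c \<notin> affine hull K"
      using face_of_imp_eq_affine_Int[OF cP face_of_facet[OF K]] cK[OF K] cP' by blast
    then show ?thesis
      using aff_dim_facet[OF K] by (simp add: aff_dim_convex_hull aff_dim_insert)
  qed
  have not_sub: "\<not> convex hull (insert c K) \<subseteq> T" if "K \<in> facets P" "aff_dim T < aff_dim P" for K T
    using aff_dim_subset[of "convex hull (insert c K)" T] dim_hull[OF that(1)] that(2) by linarith
  have hull_sub: "convex hull (insert c K) \<subseteq> P" if "K \<in> facets P" for K
    using hull_minimal[of "insert c K" P convex] cP cP' facet_sub[OF that] by auto
  obtain x where x: "x \<in> convex hull (insert c G0)" "\<And>T. T \<in> \<T> \<Longrightarrow> x \<notin> T"
  proof (rule convex_avoid_finite_affine[OF fin, of "convex hull (insert c G0)"])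
    show "\<not> convex hull (insert c G0) \<subseteq> T" if "T \<in> \<T>" for T
      using not_sub[OF G0, of T] dimT[OF that] by linarith
  qed (use aff in auto)
  \<comment> \<open>If the segment met \<open>T\<close>, which misses \<open>x\<close>, then
    \<open>y\<close> would lie in the hull of \<open>x\<close> and \<open>T\<close>. As
    \<open>T\<close> has codimension at least 2, this hull still has smaller dimension than
    \<open>P\<close> and can be avoided.\<close>
  obtain y where y: "y \<in> convex hull (insert c H0)" "\<And>T. T \<in> \<T> \<Longrightarrow> y \<notin> affine hull (insert x T)"
  proof (rule convex_avoid_finite_affine[of "(\<lambda>T. affine hull (insert x T)) ` \<T>" "convex hull (insert c H0)"])
    show "\<not> convex hull (insert c H0) \<subseteq> T'" if "T' \<in> (\<lambda>T. affine hull (insert x T)) ` \<T>" for T'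
    proof -
      obtain T where T: "T \<in> \<T>" "T' = affine hull (insert x T)"
        using \<open>T' \<in> _\<close> by blast
      have "aff_dim T' < aff_dim P"
        using dimT[OF T(1)] by (simp add: T(2) aff_dim_affine_hull aff_dim_insert)
      then show ?thesis
        by (rule not_sub[OF H0])
    qed
  qed (use fin in auto)
  have seg_T: "z \<notin> T" if z: "z \<in> closed_segment x y" and T: "T \<in> \<T>" for z T
  proof
    assume zT: "z \<in> T"
    obtain u where u: "0 \<le> u" "u \<le> 1" "z = (1 - u) *\<^sub>R x + u *\<^sub>R y"
      using z by (auto simp: in_segment)
    have "u \<noteq> 0"
      using u(3) zT x(2)[OF T] by auto
    have "(1 / u) *\<^sub>R z + (1 - 1 / u) *\<^sub>R x = ((1 / u) * (1 - u) + (1 - 1 / u)) *\<^sub>R x + y"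
      using \<open>u \<noteq> 0\<close> unfolding u(3) scaleR_add_left scaleR_add_right scaleR_scaleR by simp
    also have "(1 / u) * (1 - u) + (1 - 1 / u) = 0"
      using \<open>u \<noteq> 0\<close> by (simp add: field_simps)
    finally have "y = (1 / u) *\<^sub>R z + (1 - 1 / u) *\<^sub>R x"
      by simp
    moreover have "z \<in> affine hull (insert x T)" "x \<in> affine hull (insert x T)"
      using zT by (simp_all add: hull_inc)
    ultimately have "y \<in> affine hull (insert x T)"
      using mem_affine[of "affine hull (insert x T)" z x "1 / u" "1 - 1 / u"] by simp
    then show False
      using y(2)[OF T] by blast
  qed
  have seg_P: "closed_segment x y \<subseteq> P"
    using x(1) y(1) hull_sub[OF G0] hull_sub[OF H0] cP by (intro closed_segment_subset) auto
  \<comment> \<open>Projecting \<open>z\<close> from \<open>c\<close> to the frontier gives a point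
    \<open>q\<close> of gauge 1, which lies in both facets. So \<open>z\<close> is on the line
    through \<open>c\<close> and a point of \<open>K \<inter> L\<close>, and this is avoided unless
    \<open>K\<close> and \<open>L\<close> are adjacent.\<close>
  have cross: "ridge_adjacent P K L"
    if KL: "K \<in> facets P" "L \<in> facets P" "K \<noteq> L" and z: "z \<in> cone K" "z \<in> cone L" "z \<in> closed_segment x y"
    for K L z
  proof (rule ccontr)
    assume "\<not> ridge_adjacent P K L"
    then have T: "affine hull (insert c (K \<inter> L)) \<in> \<T>"
      using KL by (auto simp: \<T>_def)
    have "z \<noteq> c"
      using seg_T[OF z(3), of "{c}"] by (auto simp: \<T>_def)
    have "c + (z - c) \<in> affine hull P"
      using z(3) seg_P by (auto simp: hull_inc)
    then obtain t where t: "0 < t" "c + t *\<^sub>R (z - c) \<in> rel_frontier P"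
      using ray_to_rel_frontier[OF bP c, of "z - c"] \<open>z \<noteq> c\<close> by auto
    then obtain M where M: "M facet_of P" "c + t *\<^sub>R (z - c) \<in> M"
      using rel_frontier_of_polyhedron[OF polytope_imp_polyhedron[OF P]] by blast
    define q where "q = c + t *\<^sub>R (z - c)"
    have M': "M \<in> facets P"
      using M(1) by (auto simp: facets_def facet_of_def)
    have qP: "q \<in> P"
      using M facet_sub[OF M'] by (auto simp: q_def)
    have "t * f M z = 1"
      using f_eq[OF M' qP] M(2) by (simp add: q_def f_scale)
    have mem: "q \<in> N" if N: "N \<in> facets P" "z \<in> cone N" for N
    proof -
      have "f M z \<le> f N z"
        using N(2) M' by (auto simp: cone_def)
      then have "1 \<le> t * f N z"
        using \<open>t * f M z = 1\<close> t(1) mult_left_mono[of "f M z" "f N z" t] by simp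
      then show ?thesis
        using f_le[OF N(1) qP] f_eq[OF N(1) qP] by (simp add: q_def f_scale)
    qed
    then have "q \<in> affine hull (insert c (K \<inter> L))"
      using KL z by (simp add: hull_inc)
    moreover have "c \<in> affine hull (insert c (K \<inter> L))"
      by (simp add: hull_inc)
    moreover have "z = (1 / t) *\<^sub>R q + (1 - 1 / t) *\<^sub>R c"
      using t(1) by (simp add: q_def scaleR_add_right scaleR_diff_left)
    ultimately have "z \<in> affine hull (insert c (K \<inter> L))"
      using mem_affine[of "affine hull (insert c (K \<inter> L))" q c "1 / t" "1 - 1 / t"] by simp
    then show False
      using seg_T[OF z(3) T] by blast
  qed
  show ?thesis
  proof (rule ccontr)
    assume not: "\<not> ?thesis"
    \<comment> \<open>The cones of the facets reachable from \<open>G0\<close>, against those of the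
      others: two closed sets covering the segment. By \<open>cross\<close> no point of the segment
      lies in both.\<close>
    define A where "A = (\<Union>K\<in>{K \<in> facets P. (ridge_adjacent P)\<^sup>*\<^sup>* G0 K}. cone K)"
    define B where "B = (\<Union>K\<in>{K \<in> facets P. \<not> (ridge_adjacent P)\<^sup>*\<^sup>* G0 K}. cone K)"
    have "closed A" "closed B"
      using finite_facets[OF P] closed_cone by (auto simp: A_def B_def intro!: closed_UN)
    moreover have "closed_segment x y \<subseteq> A \<union> B"
    proof
      fix z
      have "Max ((\<lambda>K. f K z) ` facets P) \<in> (\<lambda>K. f K z) ` facets P"
        using finite_facets[OF P] G0 by (intro Max_in) auto
      then obtain K where K: "K \<in> facets P" "f K z = Max ((\<lambda>K. f K z) ` facets P)"
        by auto
      then have "z \<in> cone K"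
        using finite_facets[OF P] by (simp add: cone_def)
      then show "z \<in> A \<union> B"
        using K(1) by (auto simp: A_def B_def)
    qed
    moreover have "A \<inter> B \<inter> closed_segment x y = {}"
    proof (rule ccontr)
      assume "A \<inter> B \<inter> closed_segment x y \<noteq> {}"
      then obtain z K L where "z \<in> closed_segment x y" "K \<in> facets P" "L \<in> facets P" "z \<in> cone K" "z \<in> cone L"
          and reach: "(ridge_adjacent P)\<^sup>*\<^sup>* G0 K" "\<not> (ridge_adjacent P)\<^sup>*\<^sup>* G0 L"
        unfolding A_def B_def by blast
      moreover from reach have "K \<noteq> L" by blast
      ultimately have "ridge_adjacent P K L"
        using cross by blast
      then show False
        using reach by (meson rtranclp.rtrancl_into_rtrancl)
    qed
    moreover have "x \<in> A"
      using x(1) hull_cone[OF G0] G0 by (auto simp: A_def)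
    moreover have "y \<in> B"
      using y(1) hull_cone[OF H0] H0 not by (auto simp: B_def)
    ultimately show False
      using connected_segment[of x y] unfolding connected_closed by (metis IntI empty_iff ends_in_segment)
  qed
qed


subsection \<open>Flags of the face lattice\<close>

lemma flag_contains_top:
  assumes "polytope P" "is_flag (faces P) (\<subseteq>) C"
  shows "P \<in> C"
proof -
  have "P face_of P"
    using assms(1) by (simp add: face_of_refl polytope_imp_convex)
  moreover have "X \<subseteq> P" if "X \<in> C" for X
    using flag_subset[OF assms(2)] that face_of_imp_subset by blast
  ultimately show ?thesis
    by (intro flag_memI[OF assms(2)]) auto
qed

text \<open>The largest proper member of the flag lies in a facet. This facet is comparable with all
  members and therefore belongs to the flag. For nonempty \<open>P\<close> the empty face ensures
  that there is a proper member.\<close>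

lemma flag_Diff_top:
  assumes P: "polytope P" "P \<noteq> {}" and C: "is_flag (faces P) (\<subseteq>) C"
  obtains G where "G \<in> facets P" "is_flag (faces G) (\<subseteq>) (C - {P})"
proof -
  note sub = flag_subset[OF C]
  have chain: "X \<subseteq> Y \<or> Y \<subseteq> X" if "X \<in> C" "Y \<in> C" for X Y
    using flag_comparable[OF C that] by blast
  have max: "X \<in> C" if "X face_of P" "\<forall>Y\<in>C. X = Y \<or> X \<subseteq> Y \<or> Y \<subseteq> X" for X
    using that by (intro flag_memI[OF C]) auto
  have "finite C"
    using finite_subset[OF sub] finite_polytope_faces[OF P(1)] by blast
  moreover have "{} \<in> C - {P}"
    using max[of "{}"] P(2) by blast
  ultimately obtain X where X: "X \<in> C - {P}" "\<And>Y. Y \<in> C - {P} \<Longrightarrow> X \<subseteq> Y \<Longrightarrow> X = Y"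
    using finite_has_maximal[of "C - {P}"] by blast
  have below: "Y \<subseteq> X" if "Y \<in> C - {P}" for Y
    using chain[of X Y] X that by blast
  have "X face_of P" "X \<noteq> P"
    using X(1) sub by auto
  then obtain G where G: "G \<in> facets P" "X \<subseteq> G"
    using proper_face_subset_facet[OF P(1)] by blast
  have "G \<subseteq> P"
    using face_of_imp_subset[OF face_of_facet[OF G(1)]] .
  have cmp: "Y \<subseteq> G \<or> Y = P" if "Y \<in> C" for Y
    using below[of Y] that G(2) by blast
  then have "G \<in> C"
    using \<open>G \<subseteq> P\<close> by (intro max[OF face_of_facet[OF G(1)]]) blast
  have "is_flag (faces G) (\<subseteq>) (C - {P})"
    unfolding is_flag_iff
  proof (intro conjI ballI impI)
    show "C - {P} \<subseteq> faces G"
      using cmp sub face_of_face[OF face_of_facet[OF G(1)]] by blast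
  next
    fix Y Z assume "Y \<in> C - {P}" "Z \<in> C - {P}"
    then show "Y = Z \<or> Y \<subseteq> Z \<or> Z \<subseteq> Y"
      using chain by blast
  next
    fix Y assume Y: "Y \<in> faces G" "\<forall>Z\<in>C - {P}. Y = Z \<or> Y \<subseteq> Z \<or> Z \<subseteq> Y"
    then have "Y face_of P" "Y \<subseteq> G"
      using face_of_face[OF face_of_facet[OF G(1)]] by blast+
    moreover have "Y \<noteq> P"
      using \<open>Y \<subseteq> G\<close> \<open>G \<subseteq> P\<close> facet_neq[OF G(1)] by blast
    moreover have "Y \<subseteq> P"
      using \<open>Y \<subseteq> G\<close> \<open>G \<subseteq> P\<close> by blast
    ultimately show "Y \<in> C - {P}"
      using Y(2) max[of Y] by blast
  qed
  with that G(1) show ?thesis by blast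
qed

text \<open>A face that is comparable with \<open>G\<close> but not inside it contains
  \<open>G\<close> strictly, so only the dimension of \<open>P\<close> is left for it.\<close>

lemma flag_insert_top:
  assumes P: "polytope P" and G: "G \<in> facets P" and D: "is_flag (faces G) (\<subseteq>) D"
  shows "is_flag (faces P) (\<subseteq>) (insert P D)" and "P \<notin> D"
proof -
  have GP: "G face_of P" "G \<subseteq> P"
    using face_of_facet[OF G] face_of_imp_subset by blast+
  have pG: "polytope G"
    using face_of_polytope_polytope[OF P GP(1)] .
  have "G \<in> D"
    using flag_contains_top[OF pG D] .
  have sub: "X face_of P" "X \<subseteq> G" if "X \<in> D" for X
    using flag_subset[OF D] that face_of_face[OF GP(1)] by blast+
  show "P \<notin> D"
    using sub(2)[of P] GP facet_neq[OF G] by blast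
  show "is_flag (faces P) (\<subseteq>) (insert P D)"
    unfolding is_flag_iff
  proof (intro conjI ballI impI)
    show "insert P D \<subseteq> faces P"
      using sub P by (auto simp: face_of_refl polytope_imp_convex)
  next
    fix X Y assume "X \<in> insert P D" "Y \<in> insert P D"
    then show "X = Y \<or> X \<subseteq> Y \<or> Y \<subseteq> X"
      using flag_comparable[OF D, of X Y] sub(2)[of X] sub(2)[of Y] GP(2) by blast
  next
    fix X assume X: "X \<in> faces P" "\<forall>Y\<in>insert P D. X = Y \<or> X \<subseteq> Y \<or> Y \<subseteq> X"
    show "X \<in> insert P D"
    proof (cases "X \<subseteq> G")
      case True
      then have "X \<in> faces G"
        using X(1) face_of_face[OF GP(1)] by blast
      then have "X \<in> D"
        using X(2) by (intro flag_memI[OF D]) auto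
      then show ?thesis by blast
    next
      case False
      then have "G \<subset> X"
        using X(2) \<open>G \<in> D\<close> by blast
      then have "aff_dim G < aff_dim X"
        using aff_dim_face_psubset[OF GP(1)] X(1) by blast
      then have "\<not> aff_dim X < aff_dim P"
        using aff_dim_facet[OF G] by simp
      then have "X = P"
        using face_of_aff_dim_lt[OF polytope_imp_convex[OF P], of X] X(1) by blast
      then show ?thesis by blast
    qed
  qed
qed

text \<open>Points need no case of their own: their facet is the empty face, where the recursion
  ends. The measure is shifted because the empty set has dimension -1.\<close>

lemma polytope_dim_induct [consumes 1, case_names empty step]:
  assumes "polytope P"
    and "Q {}"
    and "\<And>P. polytope P \<Longrightarrow> P \<noteq> {} \<Longrightarrow> (\<And>G. G \<in> facets P \<Longrightarrow> Q G) \<Longrightarrow> Q P"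
  shows "Q P"
  using assms(1)
proof (induction "nat (aff_dim P + 1)" arbitrary: P rule: less_induct)
  case less
  show ?case
  proof (cases "P = {}")
    case False
    show ?thesis
    proof (rule assms(3)[OF less.prems False])
      fix G assume G: "G \<in> facets P"
      have "aff_dim P \<ge> 0"
        using False by (metis aff_dim_negative_iff not_le)
      then have "nat (aff_dim G + 1) < nat (aff_dim P + 1)"
        using aff_dim_facet[OF G] by simp
      then show "Q G"
        using less face_of_polytope_polytope[OF less.prems face_of_facet[OF G]] by blast
    qed
  qed (simp add: assms(2))
qed

lemma flag_faces_empty: "is_flag (faces {}) (\<subseteq>) C \<longleftrightarrow> C = {{}}"
  by (auto simp: is_flag_iff)

theorem card_flag_faces:
  assumes "polytope P" "is_flag (faces P) (\<subseteq>) C"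
  shows "card C = nat (aff_dim P + 2)"
  using assms
proof (induction P arbitrary: C rule: polytope_dim_induct)
  case empty
  then show ?case
    unfolding flag_faces_empty by simp
next
  case (step P)
  obtain G where G: "G \<in> facets P" "is_flag (faces G) (\<subseteq>) (C - {P})"
    using flag_Diff_top[OF step.hyps step.prems] by blast
  then have "card (C - {P}) = nat (aff_dim G + 2)"
    using step.IH by blast
  moreover have "finite C"
    using flag_subset[OF step.prems] finite_polytope_faces[OF step.hyps(1)] by (rule finite_subset)
  ultimately have "card C = Suc (nat (aff_dim G + 2))"
    using flag_contains_top[OF step.hyps(1) step.prems] card.remove by metis
  then show ?case
    using aff_dim_facet[OF G(1)] aff_dim_geq[of G] by simp
qed

lemma flag_exists_faces:
  assumes "polytope P"
  obtains C where "is_flag (faces P) (\<subseteq>) C"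
  using chain_imp_flag[OF finite_polytope_faces[OF assms], of "(\<subseteq>)" "{}"]
  by (auto simp: chain_iff)

lemma flag_path_insert_top:
  assumes P: "polytope P" and G: "G \<in> facets P"
    and path: "(flag_adjacent (faces G) (\<subseteq>))\<^sup>*\<^sup>* D E"
  shows "(flag_adjacent (faces P) (\<subseteq>))\<^sup>*\<^sup>* (insert P D) (insert P E)"
  using path
proof (induction rule: rtranclp_induct)
  case (step E F)
  have EF: "is_flag (faces G) (\<subseteq>) E" "is_flag (faces G) (\<subseteq>) F" "card (E - F) = 1"
    using step.hyps(2) by (auto simp: flag_adjacent_def)
  have "insert P E - insert P F = E - F"
    using flag_insert_top(2)[OF P G EF(1)] by blast
  then have "flag_adjacent (faces P) (\<subseteq>) (insert P E) (insert P F)"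
    using flag_insert_top(1)[OF P G] EF by (simp add: flag_adjacent_def)
  then show ?case
    using step.IH by (meson rtranclp.rtrancl_into_rtrancl)
qed simp

text \<open>
  Flags with the same facet are connected within this facet. Two facets \<open>G\<close>, \<open>H\<close> that meet in a
  ridge have flags through the ridge which differ in \<open>G\<close>, \<open>H\<close> only.
\<close>

theorem flags_faces_connected:
  assumes "polytope P" "is_flag (faces P) (\<subseteq>) C" "is_flag (faces P) (\<subseteq>) D"
  shows "(flag_adjacent (faces P) (\<subseteq>))\<^sup>*\<^sup>* C D"
  using assms
proof (induction P arbitrary: C D rule: polytope_dim_induct)
  case empty
  then show ?case
    unfolding flag_faces_empty by simp
next
  case (step P)
  note P = step.hyps(1)
  let ?path = "(flag_adjacent (faces P) (\<subseteq>))\<^sup>*\<^sup>*"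
  have same: "?path (insert P D) (insert P E)"
    if "G \<in> facets P" "is_flag (faces G) (\<subseteq>) D" "is_flag (faces G) (\<subseteq>) E" for G D E
    using flag_path_insert_top[OF P that(1)] step.IH[OF that(1)] that by blast
  have neighbour: "\<exists>D' E'. is_flag (faces G) (\<subseteq>) D' \<and> is_flag (faces H) (\<subseteq>) E' \<and>
      ?path (insert P D') (insert P E')" if GH: "ridge_adjacent P G H" for G H
  proof (cases "G = H")
    case True
    have "polytope G"
      using GH face_of_polytope_polytope[OF P face_of_facet] by (auto simp: ridge_adjacent_def)
    then obtain D' where "is_flag (faces G) (\<subseteq>) D'"
      using flag_exists_faces by blast
    then show ?thesis
      using True by blast
  next
    case False
    have G: "G \<in> facets P" and H: "H \<in> facets P" and dim: "aff_dim (G \<inter> H) = aff_dim P - 2"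
      using GH by (auto simp: ridge_adjacent_def)
    have pG: "polytope G" and pH: "polytope H"
      using G H face_of_polytope_polytope[OF P face_of_facet] by auto
    have int: "G \<inter> H face_of P"
      using face_of_Int[OF face_of_facet[OF G] face_of_facet[OF H]] .
    have R: "G \<inter> H \<in> facets G" "G \<inter> H \<in> facets H"
      using int dim aff_dim_facet[OF G] aff_dim_facet[OF H]
        face_of_face[OF face_of_facet[OF G]] face_of_face[OF face_of_facet[OF H]]
      by (auto simp: facets_def)
    have "polytope (G \<inter> H)"
      using face_of_polytope_polytope[OF P int] .
    then obtain E where E: "is_flag (faces (G \<inter> H)) (\<subseteq>) E"
      using flag_exists_faces by blast
    note DG = flag_insert_top[OF pG R(1) E] and DH = flag_insert_top[OF pH R(2) E]
    have "insert P (insert G E) - insert P (insert H E) = {G}"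
      using False DG(2) facet_neq[OF G] by blast
    then have "flag_adjacent (faces P) (\<subseteq>) (insert P (insert G E)) (insert P (insert H E))"
      using flag_insert_top(1)[OF P G DG(1)] flag_insert_top(1)[OF P H DH(1)]
      by (simp add: flag_adjacent_def)
    then show ?thesis
      using DG(1) DH(1) by blast
  qed
  have all: "?path (insert P D) (insert P E)"
    if "(ridge_adjacent P)\<^sup>*\<^sup>* G H" "G \<in> facets P" "is_flag (faces G) (\<subseteq>) D" "is_flag (faces H) (\<subseteq>) E"
    for G H D E
    using that
  proof (induction arbitrary: E rule: rtranclp_induct)
    case base
    then show ?case
      using same by blast
  next
    case (step H K)
    obtain D' E' where DE: "is_flag (faces H) (\<subseteq>) D'" "is_flag (faces K) (\<subseteq>) E'"
        "?path (insert P D') (insert P E')"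
      using neighbour[OF step.hyps(2)] by blast
    have K: "K \<in> facets P"
      using step.hyps(2) by (simp add: ridge_adjacent_def)
    have "?path (insert P D) (insert P D')"
      using step DE(1) by blast
    moreover have "?path (insert P E') (insert P E)"
      using same[OF K DE(2)] step.prems by blast
    ultimately show ?case
      using DE(3) by (meson rtranclp_trans)
  qed
  obtain G where G: "G \<in> facets P" "is_flag (faces G) (\<subseteq>) (C - {P})"
    using flag_Diff_top[OF step.hyps step.prems(1)] by blast
  obtain H where H: "H \<in> facets P" "is_flag (faces H) (\<subseteq>) (D - {P})"
    using flag_Diff_top[OF step.hyps step.prems(2)] by blast
  have "insert P (C - {P}) = C" "insert P (D - {P}) = D"
    using flag_contains_top[OF P] step.prems by blast+
  then show ?case
    using all[OF facets_ridge_connected[OF P G(1) H(1)] G H(2)] by simp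
qed

section \<open>Rank function and diamond property of the face lattice\<close>

definition face_rank :: "'a::euclidean_space set \<Rightarrow> nat" where
  "face_rank X = nat (aff_dim X + 1)"

text \<open>\<open>nat\<close> truncates nothing: the least dimension is -1, so the empty face gets
  rank 0.\<close>

lemma int_face_rank: "int (face_rank X) = aff_dim X + 1"
  using aff_dim_geq[of X] by (simp add: face_rank_def)

lemma ranked_faces:
  assumes "polytope P"
  shows "ranked_poset (faces P) face_rank (face_rank P)"
proof
  fix X Y assume XY: "X \<in> faces P" "Y \<in> faces P" "X < Y"
  then have "aff_dim X < aff_dim Y"
    using aff_dim_face_psubset by blast
  then show "face_rank X < face_rank Y"
    using int_face_rank[of X] int_face_rank[of Y] by linarith
next
  fix X assume "X \<in> faces P"
  then have "aff_dim X \<le> aff_dim P"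
    by (simp add: aff_dim_subset face_of_imp_subset)
  then show "face_rank X \<le> face_rank P"
    using int_face_rank[of X] int_face_rank[of P] by linarith
qed (use finite_polytope_faces[OF assms] in simp)

lemma card_flag_faces':
  assumes "polytope P" "is_flag (faces P) (\<subseteq>) C"
  shows "card C = Suc (face_rank P)"
  using card_flag_faces[OF assms] int_face_rank[of P] by simp

lemma flag_connected_faces:
  assumes "polytope P"
  shows "flag_connected (faces P) (\<subseteq>)"
  using card_flag_faces[OF assms] flags_faces_connected[OF assms]
  unfolding flag_connected_def graded_def by blast

lemma poset_rank_faces:
  assumes "polytope P"
  shows "poset_rank (faces P) (\<subseteq>) = face_rank P"
  using poset_rank_eqI[OF finite_polytope_faces[OF assms]] card_flag_faces'[OF assms] by blast

lemma diamond_faces: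
  assumes P: "polytope P"
  shows "diamond (faces P) (\<subseteq>)"
  unfolding diamond_def
proof (intro conjI ballI impI)
  show "graded (faces P) (\<subseteq>)"
    using flag_connected_faces[OF P] by (simp add: flag_connected_def)
next
  interpret ranked_poset "faces P" face_rank "face_rank P"
    using ranked_faces[OF P] .
  fix X Y assume X: "X \<in> faces P" and Y: "Y \<in> faces P"
    and XY: "X \<subseteq> Y \<and> elem_rank (faces P) (\<subseteq>) Y = elem_rank (faces P) (\<subseteq>) X + 2"
  have pY: "polytope Y"
    using face_of_polytope_polytope[OF P] Y by blast
  have "face_rank Y = face_rank X + 2"
    using elem_rank_eq[OF card_flag_faces'[OF P] X] elem_rank_eq[OF card_flag_faces'[OF P] Y] XY
    by simp
  then have "aff_dim Y = aff_dim X + 2"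
    using int_face_rank[of X] int_face_rank[of Y] by linarith
  moreover have "X face_of Y"
    using X Y XY face_of_face by blast
  ultimately have "card {F. F face_of Y \<and> X \<subseteq> F} = 4"
    using card_rank_two_interval[OF pY] by blast
  moreover have "{F \<in> faces P. X \<subseteq> F \<and> F \<subseteq> Y} = {F. F face_of Y \<and> X \<subseteq> F}"
    using Y face_of_face by blast
  ultimately show "card {c \<in> faces P. X \<subseteq> c \<and> c \<subseteq> Y} = 4"
    by simp
qed

text \<open>The empty face and \<open>P\<close> are the only faces of extreme rank, which fixes both
  ends of every flag as \<open>diamond_subset_eq\<close> requires.\<close>

lemma subposet_of_faces_eq:
  assumes P: "polytope P" and B: "B \<subseteq> faces P"
    and "\<And>C. is_flag B (\<subseteq>) C \<Longrightarrow> card C = Suc (face_rank P)" "diamond B (\<subseteq>)"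
  shows "B = faces P"
proof -
  interpret ranked_poset "faces P" face_rank "face_rank P"
    using ranked_faces[OF P] .
  show ?thesis
  proof (rule diamond_subset_eq)
    fix X Y assume "X \<in> faces P" "Y \<in> faces P" "face_rank X = 0" "face_rank Y = 0"
    then show "X = Y"
      using int_face_rank[of X] int_face_rank[of Y] aff_dim_empty[of X] aff_dim_empty[of Y] by simp
  next
    fix X Y assume "X \<in> faces P" "Y \<in> faces P" "face_rank X = face_rank P" "face_rank Y = face_rank P"
    then have "X = P" "Y = P"
      using face_of_aff_dim_lt[OF polytope_imp_convex[OF P]] int_face_rank
      by (metis less_irrefl mem_Collect_eq add_right_cancel)+
    then show "X = Y" by simp
  qed (use assms card_flag_faces'[OF P] flag_connected_faces[OF P] diamond_faces[OF P] in auto)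
qed


section \<open>Maxbicliques of a polytope type\<close>

text \<open>Maxbicliques are the formal concepts of \<open>R\<close>: each side consists of all
  common neighbours of the other. Adding a single row or column suffices to test maximality.\<close>

lemma maxbicliques_iff:
  "B \<in> maxbicliques I J R \<longleftrightarrow>
     fst B = {i \<in> I. \<forall>j\<in>snd B. (i, j) \<in> R} \<and> snd B = {j \<in> J. \<forall>i\<in>fst B. (i, j) \<in> R}"
  (is "?l \<longleftrightarrow> ?r")
proof
  assume ?l
  then have B: "biclique I J R B"
    and max: "\<And>C. biclique I J R C \<Longrightarrow> fst B \<subseteq> fst C \<Longrightarrow> snd B \<subseteq> snd C \<Longrightarrow> C = B"
    by (auto simp: maxbicliques_def)
  have "i \<in> fst B" if "i \<in> I" "\<forall>j\<in>snd B. (i, j) \<in> R" for i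
  proof -
    have "(insert i (fst B), snd B) = B"
      using B that by (intro max) (auto simp: biclique_def)
    then show ?thesis
      by (metis fst_conv insertI1)
  qed
  moreover have "j \<in> snd B" if "j \<in> J" "\<forall>i\<in>fst B. (i, j) \<in> R" for j
  proof -
    have "(fst B, insert j (snd B)) = B"
      using B that by (intro max) (auto simp: biclique_def)
    then show ?thesis
      by (metis snd_conv insertI1)
  qed
  ultimately show ?r
    using B by (auto simp: biclique_def)
next
  assume r: ?r
  then have fst: "i \<in> fst B \<longleftrightarrow> i \<in> I \<and> (\<forall>j\<in>snd B. (i, j) \<in> R)"
    and snd: "j \<in> snd B \<longleftrightarrow> j \<in> J \<and> (\<forall>i\<in>fst B. (i, j) \<in> R)" for i j
    by blast+
  have "C = B" if C: "biclique I J R C" "fst B \<subseteq> fst C" "snd B \<subseteq> snd C" for C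
  proof (rule prod_eqI)
    show "fst C = fst B"
    proof
      show "fst C \<subseteq> fst B"
        using C fst unfolding biclique_def by blast
    qed (fact C(2))
    show "snd C = snd B"
    proof
      show "snd C \<subseteq> snd B"
        using C snd unfolding biclique_def by blast
    qed (fact C(3))
  qed
  moreover have "biclique I J R B"
    using fst snd unfolding biclique_def by blast
  ultimately show ?l
    unfolding maxbicliques_def by blast
qed

lemma maxbiclique_fst: "B \<in> maxbicliques I J R \<Longrightarrow> i \<in> fst B \<longleftrightarrow> i \<in> I \<and> (\<forall>j\<in>snd B. (i, j) \<in> R)"
  unfolding maxbicliques_iff by blast

lemma maxbiclique_snd: "B \<in> maxbicliques I J R \<Longrightarrow> j \<in> snd B \<longleftrightarrow> j \<in> J \<and> (\<forall>i\<in>fst B. (i, j) \<in> R)"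
  unfolding maxbicliques_iff by blast

lemma maxbiclique_eqI:
  "B \<in> maxbicliques I J R \<Longrightarrow> C \<in> maxbicliques I J R \<Longrightarrow> snd B = snd C \<Longrightarrow> B = C"
  unfolding maxbicliques_iff by (metis prod_eqI)

text \<open>The least maxbiclique containing column \<open>j\<close>. If \<open>R\<close> is
  irredundant its column set is \<open>{j}\<close>, which later makes \<open>w j\<close> a
  vertex.\<close>

lemma maxbiclique_of_column:
  assumes "j \<in> J"
  shows "(R\<inverse> `` {j} \<inter> I, {k \<in> J. R\<inverse> `` {j} \<inter> I \<subseteq> R\<inverse> `` {k}}) \<in> maxbicliques I J R"
  unfolding maxbicliques_iff using assms by auto

lemma maxbicliques_nonempty: "maxbicliques I J R \<noteq> {}"
proof -
  have "({i \<in> I. J \<subseteq> R `` {i}}, {j \<in> J. \<forall>i\<in>{i \<in> I. J \<subseteq> R `` {i}}. (i, j) \<in> R}) \<in> maxbicliques I J R"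
    unfolding maxbicliques_iff by auto
  then show ?thesis by blast
qed

locale type_polytope =
  fixes I :: "'i set" and J :: "'j set" and R :: "('i \<times> 'j) set"
    and P :: "'a::euclidean_space set" and F :: "'i \<Rightarrow> 'a set" and w :: "'j \<Rightarrow> 'a"
  assumes type: "(P, F, w) \<in> type_polytopes I J R" and R: "R \<subseteq> I \<times> J"
begin

lemma polytope: "polytope P"
  and bij_F: "bij_betw F I (facets P)" and bij_w: "bij_betw w J (vertices P)"
  and R_iff: "i \<in> I \<Longrightarrow> j \<in> J \<Longrightarrow> (i, j) \<in> R \<longleftrightarrow> w j \<in> F i"
  using type by (auto simp: type_polytopes_def)

lemma facet: "i \<in> I \<Longrightarrow> F i \<in> facets P"
  using bij_F by (auto simp: bij_betw_def)

lemma facet_label: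
  assumes "G \<in> facets P"
  shows "\<exists>i\<in>I. F i = G"
proof -
  have "G \<in> F ` I"
    using bij_F assms by (simp add: bij_betw_def)
  then show ?thesis by blast
qed

lemma vertex: "j \<in> J \<Longrightarrow> w j extreme_point_of P"
  using bij_w by (auto simp: bij_betw_def vertices_def)

lemma vertex_label:
  assumes "x extreme_point_of P"
  shows "\<exists>j\<in>J. w j = x"
proof -
  have "x \<in> w ` J"
    using bij_w assms by (simp add: bij_betw_def vertices_def)
  then show ?thesis by blast
qed

lemma vertex_in: "j \<in> J \<Longrightarrow> w j \<in> P"
  using vertex by (simp add: extreme_point_of_def)

lemma face_eq_convex_hull:
  assumes "X face_of P"
  shows "X = convex hull (w ` {j \<in> J. w j \<in> X})"
proof -
  have "polytope X"
    using face_of_polytope_polytope[OF polytope assms] .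
  then have "X = convex hull {x. x extreme_point_of X}"
    by (intro Krein_Milman_Minkowski polytope_imp_compact polytope_imp_convex)
  also have "{x. x extreme_point_of X} = w ` {j \<in> J. w j \<in> X}"
    using extreme_point_of_face[OF assms] vertex vertex_label by blast
  finally show ?thesis .
qed

lemma polytope_eq_convex_hull: "P = convex hull (w ` J)"
proof -
  have "{j \<in> J. w j \<in> P} = J"
    using vertex_in by blast
  then show ?thesis
    using face_eq_convex_hull[of P] face_of_refl[OF polytope_imp_convex[OF polytope]] by simp
qed

lemma face_subset_iff:
  assumes "X face_of P" "convex Y"
  shows "X \<subseteq> Y \<longleftrightarrow> (\<forall>j\<in>J. w j \<in> X \<longrightarrow> w j \<in> Y)"
proof
  assume "\<forall>j\<in>J. w j \<in> X \<longrightarrow> w j \<in> Y"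
  then have "convex hull (w ` {j \<in> J. w j \<in> X}) \<subseteq> Y"
    using assms(2) by (intro hull_minimal) auto
  then show "X \<subseteq> Y"
    using face_eq_convex_hull[OF assms(1)] by simp
qed blast

lemma vertex_in_face_iff:
  assumes "X face_of P" "j \<in> J"
  shows "w j \<in> X \<longleftrightarrow> (\<forall>i\<in>I. X \<subseteq> F i \<longrightarrow> w j \<in> F i)"
proof
  assume all: "\<forall>i\<in>I. X \<subseteq> F i \<longrightarrow> w j \<in> F i"
  show "w j \<in> X"
  proof (rule face_Inter_facets[OF polytope assms(1) vertex_in[OF assms(2)]])
    fix G assume "G \<in> facets P" "X \<subseteq> G"
    then show "w j \<in> G"
      using all facet_label by blast
  qed
qed blast

definition labels :: "'a set \<Rightarrow> 'i set \<times> 'j set" where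
  "labels X = ({i \<in> I. X \<subseteq> F i}, {j \<in> J. w j \<in> X})"

lemma labels_maxbiclique:
  assumes "X face_of P"
  shows "labels X \<in> maxbicliques I J R"
proof -
  have "i \<in> fst (labels X) \<longleftrightarrow> i \<in> I \<and> (\<forall>j\<in>snd (labels X). (i, j) \<in> R)" for i
  proof (cases "i \<in> I")
    case True
    then show ?thesis
      using face_subset_iff[OF assms face_of_imp_convex[OF face_of_facet[OF facet[OF True]]]] R_iff
      by (auto simp: labels_def)
  qed (simp add: labels_def)
  moreover have "j \<in> snd (labels X) \<longleftrightarrow> j \<in> J \<and> (\<forall>i\<in>fst (labels X). (i, j) \<in> R)" for j
  proof (cases "j \<in> J")
    case True
    then show ?thesis
      using vertex_in_face_iff[OF assms True] R_iff by (auto simp: labels_def)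
  qed (simp add: labels_def)
  ultimately show ?thesis
    unfolding maxbicliques_iff by blast
qed

lemma labels_le_iff:
  assumes "X face_of P" "Y face_of P"
  shows "maxbiclique_le (labels X) (labels Y) \<longleftrightarrow> X \<subseteq> Y"
  using face_subset_iff[OF assms(1) face_of_imp_convex[OF assms(2)]]
  by (auto simp: maxbiclique_le_def labels_def)

lemma labels_surj:
  assumes B: "B \<in> maxbicliques I J R"
  obtains X where "X face_of P" "labels X = B"
proof -
  \<comment> \<open>Inserting \<open>P\<close> takes care of \<open>fst B = {}\<close>, where the
    intersection would be the whole space.\<close>
  define X where "X = \<Inter>(insert P (F ` fst B))"
  have sub: "fst B \<subseteq> I" "snd B \<subseteq> J"
    using maxbiclique_fst[OF B] maxbiclique_snd[OF B] by blast+
  have face: "X face_of P"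
    unfolding X_def
  proof (rule face_of_Inter)
    fix T assume "T \<in> insert P (F ` fst B)"
    then show "T face_of P"
      using sub facet face_of_facet face_of_refl[OF polytope_imp_convex[OF polytope]] by blast
  qed simp
  have "snd (labels X) = snd B"
  proof (intro set_eqI)
    fix j
    have "w j \<in> X \<longleftrightarrow> (\<forall>i\<in>fst B. (i, j) \<in> R)" if j: "j \<in> J"
    proof -
      have "w j \<in> X \<longleftrightarrow> (\<forall>i\<in>fst B. w j \<in> F i)"
        using vertex_in[OF j] by (simp add: X_def)
      then show ?thesis
        using sub(1) R_iff[OF _ j] by blast
    qed
    then show "j \<in> snd (labels X) \<longleftrightarrow> j \<in> snd B"
      using maxbiclique_snd[OF B] by (auto simp: labels_def)
  qed
  then have "labels X = B"
    using maxbiclique_eqI[OF labels_maxbiclique[OF face] B] by blast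
  with that face show ?thesis by blast
qed

lemma order_iso_labels: "order_iso (faces P) (\<subseteq>) (maxbicliques I J R) maxbiclique_le labels"
proof
  have "inj_on labels (faces P)"
    by (intro inj_onI) (metis labels_le_iff mem_Collect_eq order_refl subset_antisym)
  moreover have "labels ` faces P = maxbicliques I J R"
    using labels_maxbiclique labels_surj by blast
  ultimately show "bij_betw labels (faces P) (maxbicliques I J R)"
    by (simp add: bij_betw_def)
qed (simp add: labels_le_iff)

text \<open>Rows: a facet is the hull of its vertices, and comparable facets coincide. Columns: a
  vertex is a face, so it is the only vertex in all the facets through it.\<close>

lemma irredundant: "irredundant I J R"
  unfolding irredundant_def
proof (intro conjI ballI impI)
  fix i i' assume i: "i \<in> I" "i' \<in> I" and sub: "R `` {i} \<subseteq> R `` {i'}"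
  have "F i \<subseteq> F i'"
    using face_subset_iff[OF face_of_facet[OF facet[OF i(1)]] face_of_imp_convex[OF face_of_facet[OF facet[OF i(2)]]]]
      sub R_iff i by blast
  then have "F i = F i'"
    using facet_subset_eq facet i by blast
  then show "i = i'"
    using bij_F i by (auto simp: bij_betw_def inj_on_def)
next
  fix j j' assume j: "j \<in> J" "j' \<in> J" and sub: "R\<inverse> `` {j} \<subseteq> R\<inverse> `` {j'}"
  have "{w j} face_of P"
    using vertex[OF j(1)] by (simp add: face_of_singleton)
  then have "w j' \<in> {w j}"
    using vertex_in_face_iff[OF _ j(2), of "{w j}"] sub R_iff j by blast
  then show "j = j'"
    using bij_w j by (auto simp: bij_betw_def inj_on_def)
qed

lemma flag_connected: "flag_connected (maxbicliques I J R) maxbiclique_le"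
  using order_iso.flag_connected_target[OF order_iso_labels flag_connected_faces[OF polytope]] .

lemma diamond: "diamond (maxbicliques I J R) maxbiclique_le"
  using order_iso.diamond_target[OF order_iso_labels diamond_faces[OF polytope]] .

lemma poset_rank: "poset_rank (maxbicliques I J R) maxbiclique_le = face_rank P"
  using order_iso.poset_rank_eq[OF order_iso_labels] poset_rank_faces[OF polytope] by simp

end


section \<open>Covertices and the facet-vertex matrix\<close>

text \<open>Riesz representation inside \<open>V\<close>: the representing vector
  \<open>adjoint \<phi> 1\<close> is projected orthogonally to \<open>V\<close>.\<close>

lemma linear_functional_on_subspace:
  fixes \<phi> :: "'a::euclidean_space \<Rightarrow> real"
  assumes "linear \<phi>" "subspace V"
  obtains h where "h \<in> V" "\<And>x. x \<in> V \<Longrightarrow> h \<bullet> x = \<phi> x"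
proof -
  obtain y z where yz: "y \<in> span V" "\<And>x. x \<in> span V \<Longrightarrow> orthogonal z x" "adjoint \<phi> 1 = y + z"
    using orthogonal_subspace_decomp_exists[of V "adjoint \<phi> 1"] by metis
  have "y \<bullet> x = \<phi> x" if "x \<in> V" for x
  proof -
    have "x \<bullet> adjoint \<phi> 1 = \<phi> x"
      using adjoint_works[OF assms(1), of x 1] by simp
    moreover have "z \<bullet> x = 0"
      using yz(2) that by (simp add: span_base orthogonal_def)
    ultimately show ?thesis
      by (simp add: yz(3) inner_add_right inner_commute)
  qed
  moreover have "y \<in> V"
    using yz(1) assms(2) by (metis span_eq_iff)
  ultimately show ?thesis
    using that by blast
qed

locale centered_polytope =
  fixes V P :: "'a::euclidean_space set"
  assumes V: "subspace V" and cent: "centered V P"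
begin

lemma polytope: "polytope P" and affine_hull: "affine hull P = V" and zero: "0 \<in> rel_interior P"
  using cent by (auto simp: centered_def)

lemma P_sub: "P \<subseteq> V"
  using affine_hull hull_subset by metis

lemma zero_in: "0 \<in> P"
  using zero rel_interior_subset by blast

lemma aff_dim: "aff_dim P = int (dim V)"
  using affine_hull V aff_dim_affine_hull[of P] by (simp add: aff_dim_subspace)

lemma ray_to_facet:
  assumes "x \<in> V" "x \<noteq> 0"
  obtains t G where "t > 0" "G \<in> facets P" "t *\<^sub>R x \<in> G"
proof -
  obtain t where t: "0 < t" "0 + t *\<^sub>R x \<in> rel_frontier P"
    using ray_to_rel_frontier[OF polytope_imp_bounded[OF polytope] zero, of x] assms affine_hull by auto
  then obtain G where "G facet_of P" "t *\<^sub>R x \<in> G"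
    using rel_frontier_of_polyhedron[OF polytope_imp_polyhedron[OF polytope]] by auto
  with t(1) that show ?thesis
    by (auto simp: facets_def facet_of_def)
qed

lemma covertex_exists:
  assumes G: "G \<in> facets P"
  obtains h where "h \<in> V" "\<And>x. x \<in> P \<Longrightarrow> h \<bullet> x \<le> 1" "G = {x \<in> P. h \<bullet> x = 1}"
proof -
  obtain a b where ab: "\<And>x. x \<in> P \<Longrightarrow> a \<bullet> x \<le> b" "\<And>x. x \<in> P \<Longrightarrow> a \<bullet> x = b \<longleftrightarrow> x \<in> G"
    using face_functional[OF polytope face_of_facet[OF G]] by blast
  \<comment> \<open>A facet misses the relative interior, so the right side \<open>b\<close> is
    positive and can be scaled to 1.\<close>
  have "0 \<notin> G"
    using face_of_disjoint_rel_interior[OF face_of_facet[OF G] facet_neq[OF G]] zero by blast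
  then have b: "b > 0"
    using ab[OF zero_in] by auto
  have "linear (\<lambda>x. (a \<bullet> x) / b)"
    by (intro linearI) (auto simp: inner_add_right add_divide_distrib)
  then obtain h where h: "h \<in> V" "\<And>x. x \<in> V \<Longrightarrow> h \<bullet> x = (a \<bullet> x) / b"
    using linear_functional_on_subspace[OF _ V] by blast
  have hP: "h \<bullet> x = (a \<bullet> x) / b" if "x \<in> P" for x
    using h(2) P_sub that by blast
  have "G = {x \<in> P. h \<bullet> x = 1}"
  proof -
    have "x \<in> G \<longleftrightarrow> h \<bullet> x = 1" if "x \<in> P" for x
      using hP[OF that] ab(2)[OF that] b by auto
    then show ?thesis
      using face_of_imp_subset[OF face_of_facet[OF G]] by blast
  qed
  moreover have "h \<bullet> x \<le> 1" if "x \<in> P" for x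
    using hP[OF that] ab(1)[OF that] b by simp
  ultimately show ?thesis
    using that h(1) by blast
qed

text \<open>The affine hull of \<open>G\<close> misses the origin, so adding 0 raises its dimension
  to that of \<open>V\<close>. For \<open>V = {0}\<close> the empty facet spans \<open>V\<close> as
  well.\<close>

lemma span_facet:
  assumes G: "G \<in> facets P"
  shows "span G = V"
proof (rule subspace_dim_equal)
  obtain h where h: "G = {x \<in> P. h \<bullet> x = 1}"
    using covertex_exists[OF G] by blast
  have "affine hull G \<subseteq> {x. h \<bullet> x = 1}"
    using h by (intro hull_minimal affine_hyperplane) auto
  then have "0 \<notin> affine hull G"
    by auto
  then have "aff_dim (insert 0 G) = int (dim V)"
    using aff_dim_facet[OF G] aff_dim by (simp add: aff_dim_insert)
  moreover have "aff_dim (insert 0 G) = int (dim (insert 0 G))"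
    by (intro aff_dim_zero) (simp add: hull_inc)
  ultimately have "dim (insert 0 G) = dim V"
    by simp
  then show "dim V \<le> dim (span G)"
    by (metis dim_span span_insert_0 order_refl)
  show "span G \<subseteq> V"
    using P_sub face_of_imp_subset[OF face_of_facet[OF G]] V by (intro span_minimal) auto
qed (simp_all add: V)

text \<open>As \<open>G\<close> spans \<open>V\<close>, a vector of \<open>V\<close> is determined
  by having product 1 with all of \<open>G\<close>. This gives uniqueness and also extremality: if
  \<open>h\<close> lies inside a segment of the polar, both ends have product 1 with all of
  \<open>G\<close>.\<close>

lemma covertex_eqI:
  assumes G: "G \<in> facets P" and h: "h \<in> V" "\<And>x. x \<in> P \<Longrightarrow> h \<bullet> x \<le> 1" "G = {x \<in> P. h \<bullet> x = 1}"
  shows "covertex V P G = h"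
proof -
  have unique: "k = h" if k: "k \<in> V" "\<And>x. x \<in> G \<Longrightarrow> k \<bullet> x = 1" for k
  proof -
    have "(k - h) \<bullet> x = 0" if "x \<in> G" for x
      using k(2)[OF that] h(3) that by (simp add: inner_diff_left)
    then have "(k - h) \<bullet> x = 0" if "x \<in> span G" for x
      using that orthogonal_to_span[of x G "k - h"] by (simp add: orthogonal_def)
    moreover have "k - h \<in> span G"
      using span_facet[OF G] k(1) h(1) V by (simp add: subspace_diff)
    ultimately have "(k - h) \<bullet> (k - h) = 0"
      by blast
    then show ?thesis by simp
  qed
  have "h \<in> vertices (polar V P)"
    unfolding vertices_def extreme_point_of_def mem_Collect_eq
  proof (intro conjI ballI notI)
    show "h \<in> polar V P"
      using h by (simp add: polar_def)
  next
    fix a b assume ab: "a \<in> polar V P" "b \<in> polar V P" and seg: "h \<in> open_segment a b"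
    obtain u where u: "0 < u" "u < 1" "h = (1 - u) *\<^sub>R a + u *\<^sub>R b" and "a \<noteq> b"
      using seg by (auto simp: in_segment)
    have "a \<bullet> x = 1 \<and> b \<bullet> x = 1" if x: "x \<in> G" for x
    proof -
      have le: "a \<bullet> x \<le> 1" "b \<bullet> x \<le> 1"
        using ab x h(3) by (auto simp: polar_def)
      have "(1 - u) * (a \<bullet> x) + u * (b \<bullet> x) = 1"
        using h(3) x u(3) by (simp add: inner_add_left)
      then have "(1 - u) * (1 - a \<bullet> x) + u * (1 - b \<bullet> x) = 0"
        by (simp add: algebra_simps)
      moreover have "(1 - u) * (1 - a \<bullet> x) \<ge> 0" "u * (1 - b \<bullet> x) \<ge> 0"
        using le u by auto
      ultimately have "(1 - u) * (1 - a \<bullet> x) = 0 \<and> u * (1 - b \<bullet> x) = 0"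
        using add_nonneg_eq_0_iff by blast
      then show ?thesis
        using u by simp
    qed
    then have "a = h" "b = h"
      using unique ab by (auto simp: polar_def)
    then show False
      using \<open>a \<noteq> b\<close> by simp
  qed
  moreover have "k = h" if k: "k \<in> vertices (polar V P)" "G = {x \<in> P. k \<bullet> x = 1}" for k
  proof (rule unique)
    show "k \<in> V"
      using k(1) by (simp add: vertices_def extreme_point_of_def polar_def)
    show "k \<bullet> x = 1" if "x \<in> G" for x
      using k(2) that by blast
  qed
  ultimately show ?thesis
    unfolding covertex_def using h(3) by (intro the_equality) blast+
qed

lemma covertex:
  assumes G: "G \<in> facets P"
  shows "covertex V P G \<in> V" "\<And>x. x \<in> P \<Longrightarrow> covertex V P G \<bullet> x \<le> 1"
    "\<And>x. x \<in> P \<Longrightarrow> covertex V P G \<bullet> x = 1 \<longleftrightarrow> x \<in> G"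
proof -
  obtain h where h: "h \<in> V" "\<And>x. x \<in> P \<Longrightarrow> h \<bullet> x \<le> 1" "G = {x \<in> P. h \<bullet> x = 1}"
    using covertex_exists[OF G] by blast
  then have eq: "covertex V P G = h"
    using covertex_eqI[OF G] by blast
  show "covertex V P G \<in> V" "\<And>x. x \<in> P \<Longrightarrow> covertex V P G \<bullet> x \<le> 1"
    "\<And>x. x \<in> P \<Longrightarrow> covertex V P G \<bullet> x = 1 \<longleftrightarrow> x \<in> G"
    unfolding eq using h by auto
qed

end

locale centered_type_polytope = type_polytope I J R P F w + centered_polytope V P
  for I :: "'i::finite set" and J :: "'j::finite set" and R and P :: "'a::euclidean_space set"
    and F w and V
begin

abbreviation cov :: "'i \<Rightarrow> 'a" where
  "cov i \<equiv> covertex V P (F i)"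

abbreviation matrix :: "real ^ 'j ^ 'i" where
  "matrix \<equiv> facet_vertex_matrix V I J (P, F, w)"

lemma matrix_nth: "i \<in> I \<Longrightarrow> j \<in> J \<Longrightarrow> matrix $ i $ j = cov i \<bullet> w j"
  by (simp add: facet_vertex_matrix_def)

lemma matrix_filled: "filled_incidence_matrix 1 I J R matrix"
proof -
  have "(cov i \<bullet> w j = 1 \<longleftrightarrow> (i, j) \<in> R) \<and> cov i \<bullet> w j \<le> 1" if "i \<in> I" "j \<in> J" for i j
    using covertex[OF facet[OF that(1)]] vertex_in[OF that(2)] R_iff[OF that] by simp
  then show ?thesis
    unfolding filled_incidence_matrix_def matrices_def
    by (auto simp: facet_vertex_matrix_def less_le)
qed

lemma w_in_V: "j \<in> J \<Longrightarrow> w j \<in> V"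
  using vertex_in P_sub by blast

lemma span_w: "span (w ` J) = V"
proof
  show "span (w ` J) \<subseteq> V"
    using w_in_V V by (intro span_minimal) auto
  have "V = affine hull (w ` J)"
    using affine_hull polytope_eq_convex_hull affine_hull_convex_hull by metis
  then show "V \<subseteq> span (w ` J)"
    using affine_hull_subset_span by metis
qed

text \<open>Evaluation at all covertices. It sends the vertices to the columns of the matrix, so
  injectivity on \<open>V\<close> turns the span of the vertices into the rank.\<close>

definition coords :: "'a \<Rightarrow> real ^ 'i" where
  "coords x = (\<chi> i. if i \<in> I then cov i \<bullet> x else 0)"

lemma linear_coords: "linear coords"
  by (intro linearI) (auto simp: coords_def vec_eq_iff inner_add_right)

text \<open>The ray through a nonzero vector of \<open>V\<close> meets some facet, and there the
  covertex of this facet takes the value 1.\<close>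

lemma inj_on_coords: "inj_on coords V"
  unfolding linear_inj_on_iff_eq_0[OF linear_coords V]
proof (intro ballI impI, rule ccontr)
  fix x assume x: "x \<in> V" "coords x = 0" "x \<noteq> 0"
  then obtain t G where t: "t > 0" "G \<in> facets P" "t *\<^sub>R x \<in> G"
    using ray_to_facet by blast
  then obtain i where i: "i \<in> I" "F i = G"
    using facet_label by blast
  have "t *\<^sub>R x \<in> P"
    using t face_of_imp_subset[OF face_of_facet] by blast
  then have "cov i \<bullet> (t *\<^sub>R x) = 1"
    using covertex(3)[OF facet[OF i(1)]] i t by blast
  moreover have "coords x $ i = 0"
    using x(2) by simp
  then have "cov i \<bullet> x = 0"
    using i(1) by (simp add: coords_def)
  ultimately show False by simp
qed

lemma column_matrix: "column j matrix = (if j \<in> J then coords (w j) else 0)"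
  by (auto simp: column_def coords_def facet_vertex_matrix_def vec_eq_iff)

lemma rank_matrix: "rank matrix = dim V"
proof -
  have "span (columns matrix) = span (coords ` w ` J)"
  proof
    have "columns matrix \<subseteq> span (coords ` w ` J)"
      by (auto simp: columns_def column_matrix span_zero intro: span_base)
    then show "span (columns matrix) \<subseteq> span (coords ` w ` J)"
      by (intro span_minimal) simp_all
    have "coords ` w ` J \<subseteq> columns matrix"
    proof
      fix y assume "y \<in> coords ` w ` J"
      then obtain j where "j \<in> J" "y = column j matrix"
        by (auto simp: column_matrix)
      then show "y \<in> columns matrix"
        by (auto simp: columns_def)
    qed
    then show "span (coords ` w ` J) \<subseteq> span (columns matrix)"
      by (rule span_mono)
  qed
  also have "\<dots> = coords ` V"
    using linear_span_image[OF linear_coords] span_w by metis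
  finally have "dim (columns matrix) = dim (coords ` V)"
    by (metis dim_span)
  also have "\<dots> = dim V"
    using dim_image_eq[OF linear_coords] inj_on_coords V by (metis V span_eq_iff)
  finally show ?thesis
    by (simp add: column_rank_def)
qed

end

text \<open>
  Composing the coordinates of the first polytope with a linear left inverse of those of the
  second one gives the linear map between two polytopes with the same matrix.
\<close>

lemma same_matrix_imp_linearly_equivalent:
  fixes I :: "'i::finite set" and J :: "'j::finite set" and V :: "'a::euclidean_space set"
  assumes "centered_type_polytope I J R P F w V" "centered_type_polytope I J R P' F' w' V"
    and eq: "facet_vertex_matrix V I J (P, F, w) = facet_vertex_matrix V I J (P', F', w')"
  shows "linearly_equivalent V I J (P, F, w) (P', F', w')"
proof -
  interpret A: centered_type_polytope I J R P F w V by fact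
  interpret B: centered_type_polytope I J R P' F' w' V by fact
  have wj: "A.coords (w j) = B.coords (w' j)" if "j \<in> J" for j
    using A.column_matrix[of j] B.column_matrix[of j] eq that by simp
  obtain g where g: "linear g" "\<And>x. x \<in> V \<Longrightarrow> g (B.coords x) = x"
    using linear_exists_left_inverse_on[OF B.linear_coords B.V B.inj_on_coords] by blast
  define T where "T = g \<circ> A.coords"
  have lin: "linear T"
    unfolding T_def using A.linear_coords g(1) by (rule linear_compose)
  have Tw: "T (w j) = w' j" if "j \<in> J" for j
    using wj[OF that] g(2)[OF B.w_in_V[OF that]] by (simp add: T_def)
  have image_w: "T ` w ` J = w' ` J"
    using Tw by (force simp: image_image)
  have TV: "T ` V = V"
    using linear_span_image[OF lin, of "w ` J"] A.span_w B.span_w image_w by simp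
  \<comment> \<open>With this identity \<open>T\<close> inherits injectivity on \<open>V\<close>
    from the coordinates of the first polytope.\<close>
  have "B.coords (T x) = A.coords x" if "x \<in> V" for x
  proof (rule linear_eq_on[where f = "\<lambda>x. B.coords (T x)" and g = A.coords and B = "w ` J"])
    show "linear (\<lambda>x. B.coords (T x))" "linear A.coords"
      using linear_compose[OF lin B.linear_coords] A.linear_coords by (simp_all add: o_def)
    show "x \<in> span (w ` J)"
      using that A.span_w by simp
  qed (use Tw wj in auto)
  then have "x = 0" if "x \<in> V" "T x = 0" for x
    using that A.inj_on_coords linear_inj_on_iff_eq_0[OF A.linear_coords A.V]
      linear_0[OF B.linear_coords] by metis
  then have "inj_on T V"
    by (simp add: linear_inj_on_iff_eq_0[OF lin A.V])
  then have bij: "bij_betw T V V"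
    using TV by (simp add: bij_betw_def)
  have TP: "T ` P = P'"
    using A.polytope_eq_convex_hull B.polytope_eq_convex_hull image_w
      convex_hull_linear_image[OF lin, of "w ` J"] by simp
  have "T ` F i = F' i" if i: "i \<in> I" for i
  proof -
    have w_iff: "w j \<in> F i \<longleftrightarrow> w' j \<in> F' i" if "j \<in> J" for j
      using A.R_iff[OF i that] B.R_iff[OF i that] by simp
    have "T ` F i = convex hull (T ` w ` {j \<in> J. w j \<in> F i})"
      using A.face_eq_convex_hull[OF face_of_facet[OF A.facet[OF i]]]
        convex_hull_linear_image[OF lin] by metis
    also have "T ` w ` {j \<in> J. w j \<in> F i} = w' ` {j \<in> J. w' j \<in> F' i}"
      using Tw w_iff by (force simp: image_image)
    also have "convex hull \<dots> = F' i"
      using B.face_eq_convex_hull[OF face_of_facet[OF B.facet[OF i]]] by simp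
    finally show ?thesis .
  qed
  then show ?thesis
    unfolding linearly_equivalent_def prod.case using lin bij TP Tw by blast
qed

text \<open>The covertex of \<open>F i\<close> and the pullback along \<open>T\<close> of the
  covertex of \<open>F' i\<close> are both 1 on \<open>F i\<close>, which spans
  \<open>V\<close>.\<close>

lemma linearly_equivalent_imp_same_matrix:
  fixes I :: "'i::finite set" and J :: "'j::finite set" and V :: "'a::euclidean_space set"
  assumes "centered_type_polytope I J R P F w V" "centered_type_polytope I J R P' F' w' V"
    and "linearly_equivalent V I J (P, F, w) (P', F', w')"
  shows "facet_vertex_matrix V I J (P, F, w) = facet_vertex_matrix V I J (P', F', w')"
proof -
  interpret A: centered_type_polytope I J R P F w V by fact
  interpret B: centered_type_polytope I J R P' F' w' V by fact
  obtain T where T: "linear T" "T ` P = P'" "\<And>i. i \<in> I \<Longrightarrow> T ` F i = F' i" "\<And>j. j \<in> J \<Longrightarrow> T (w j) = w' j"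
    using assms(3) by (auto simp: linearly_equivalent_def)
  have "A.cov i \<bullet> w j = B.cov i \<bullet> w' j" if i: "i \<in> I" and j: "j \<in> J" for i j
  proof -
    have "A.cov i \<bullet> x = B.cov i \<bullet> T x" if x: "x \<in> F i" for x
    proof -
      have "x \<in> P" "T x \<in> F' i" "T x \<in> P'"
        using x T i face_of_imp_subset[OF face_of_facet[OF A.facet[OF i]]] by blast+
      then show ?thesis
        using A.covertex(3)[OF A.facet[OF i]] B.covertex(3)[OF B.facet[OF i]] x by metis
    qed
    moreover have "linear (\<lambda>x. A.cov i \<bullet> x)" "linear (\<lambda>x. B.cov i \<bullet> T x)"
      using T(1) by (auto intro!: linearI simp: inner_add_right linear_add linear_cmul)
    moreover have "w j \<in> span (F i)"
      using A.span_facet[OF A.facet[OF i]] A.w_in_V[OF j] by simp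
    ultimately have "A.cov i \<bullet> w j = B.cov i \<bullet> T (w j)"
      using linear_eq_on[of "\<lambda>x. A.cov i \<bullet> x" "\<lambda>x. B.cov i \<bullet> T x" "w j" "F i"] by blast
    then show ?thesis
      using T(4)[OF j] by simp
  qed
  then show ?thesis
    by (simp add: facet_vertex_matrix_def vec_eq_iff)
qed


section \<open>Polytopes from filled incidence matrices\<close>

text \<open>No geometry is assumed: that the \<open>F i\<close> are the facets, the
  \<open>w j\<close> the vertices and 0 a relative interior point are conclusions.\<close>

locale realization =
  fixes I :: "'i::finite set" and J :: "'j::finite set" and R :: "('i \<times> 'j) set"
    and V :: "'a::euclidean_space set" and h :: "'i \<Rightarrow> 'a" and w :: "'j \<Rightarrow> 'a"
  assumes R: "R \<subseteq> I \<times> J" and V: "subspace V"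
    and h_in: "\<And>i. i \<in> I \<Longrightarrow> h i \<in> V" and w_in: "\<And>j. j \<in> J \<Longrightarrow> w j \<in> V"
    and eq_1: "\<And>i j. i \<in> I \<Longrightarrow> j \<in> J \<Longrightarrow> (i, j) \<in> R \<Longrightarrow> h i \<bullet> w j = 1"
    and less_1: "\<And>i j. i \<in> I \<Longrightarrow> j \<in> J \<Longrightarrow> (i, j) \<notin> R \<Longrightarrow> h i \<bullet> w j < 1"
    and irred: "irredundant I J R"
    and gr: "graded (maxbicliques I J R) maxbiclique_le"
    and rk: "poset_rank (maxbicliques I J R) maxbiclique_le = dim V + 1"
    and dia: "diamond (maxbicliques I J R) maxbiclique_le"
begin

definition P :: "'a set" where
  "P = convex hull (w ` J)"

definition F :: "'i \<Rightarrow> 'a set" where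
  "F i = {x \<in> P. h i \<bullet> x = 1}"

lemma polytope: "polytope P"
  unfolding P_def by (rule polytope_convex_hull) simp

lemma w_in_P: "j \<in> J \<Longrightarrow> w j \<in> P"
  by (simp add: P_def hull_inc)

lemma P_sub: "P \<subseteq> V"
  unfolding P_def using w_in V by (intro hull_minimal) (auto intro: subspace_imp_convex)

lemma h_le: "i \<in> I \<Longrightarrow> x \<in> P \<Longrightarrow> h i \<bullet> x \<le> 1"
proof -
  assume i: "i \<in> I"
  have "P \<subseteq> {x. h i \<bullet> x \<le> 1}"
    unfolding P_def
  proof (rule hull_minimal)
    have "h i \<bullet> w j \<le> 1" if "j \<in> J" for j
      using eq_1[OF i that] less_1[OF i that] by fastforce
    then show "w ` J \<subseteq> {x. h i \<bullet> x \<le> 1}"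
      by auto
  qed (rule convex_halfspace_le)
  then show "x \<in> P \<Longrightarrow> h i \<bullet> x \<le> 1" by blast
qed

lemma w_in_F: "i \<in> I \<Longrightarrow> j \<in> J \<Longrightarrow> w j \<in> F i \<longleftrightarrow> (i, j) \<in> R"
  using eq_1[of i j] less_1[of i j] w_in_P[of j] by (cases "(i, j) \<in> R") (auto simp: F_def)

lemma F_face: "i \<in> I \<Longrightarrow> F i face_of P"
proof -
  assume "i \<in> I"
  then have "(P \<inter> {x. h i \<bullet> x = 1}) face_of P"
    using h_le polytope by (intro face_of_Int_supporting_hyperplane_le polytope_imp_convex) auto
  then show ?thesis
    by (simp add: F_def Collect_conj_eq)
qed

text \<open>The construction of \<open>labels_surj\<close>, at a stage where the \<open>F i\<close>
  are known to be faces but not yet facets.\<close>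

definition face :: "'i set \<times> 'j set \<Rightarrow> 'a set" where
  "face B = \<Inter>(insert P (F ` fst B))"

lemma maxbiclique_sub: "B \<in> maxbicliques I J R \<Longrightarrow> fst B \<subseteq> I" "B \<in> maxbicliques I J R \<Longrightarrow> snd B \<subseteq> J"
  by (simp_all add: maxbicliques_def biclique_def)

lemma face_face_of:
  assumes "B \<in> maxbicliques I J R"
  shows "face B face_of P"
  unfolding face_def
proof (rule face_of_Inter)
  fix T assume "T \<in> insert P (F ` fst B)"
  then show "T face_of P"
    using maxbiclique_sub(1)[OF assms] F_face face_of_refl[OF polytope_imp_convex[OF polytope]]
    by blast
qed simp

lemma w_in_face: "B \<in> maxbicliques I J R \<Longrightarrow> j \<in> J \<Longrightarrow> w j \<in> face B \<longleftrightarrow> j \<in> snd B"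
proof -
  assume B: "B \<in> maxbicliques I J R" and j: "j \<in> J"
  have "w j \<in> face B \<longleftrightarrow> (\<forall>i\<in>fst B. w j \<in> F i)"
    using w_in_P[OF j] by (simp add: face_def)
  also have "\<dots> \<longleftrightarrow> (\<forall>i\<in>fst B. (i, j) \<in> R)"
    using maxbiclique_sub(1)[OF B] w_in_F[OF _ j] by (intro ball_cong) auto
  also have "\<dots> \<longleftrightarrow> j \<in> snd B"
    using maxbiclique_snd[OF B] j by blast
  finally show ?thesis .
qed

lemma face_subset_iff:
  assumes B: "B \<in> maxbicliques I J R" and C: "C \<in> maxbicliques I J R"
  shows "face B \<subseteq> face C \<longleftrightarrow> snd B \<subseteq> snd C"
proof
  assume "face B \<subseteq> face C"
  then show "snd B \<subseteq> snd C"
    using w_in_face[OF B] w_in_face[OF C] maxbiclique_sub(2)[OF B] by blast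
next
  assume "snd B \<subseteq> snd C"
  then have "fst C \<subseteq> fst B"
    using maxbiclique_fst[OF B] maxbiclique_fst[OF C] by blast
  then show "face B \<subseteq> face C"
    unfolding face_def by blast
qed

definition biclique_faces :: "'a set set" where
  "biclique_faces = face ` maxbicliques I J R"

lemma order_iso_face: "order_iso (maxbicliques I J R) maxbiclique_le biclique_faces (\<subseteq>) face"
proof
  have "inj_on face (maxbicliques I J R)"
    by (intro inj_onI maxbiclique_eqI subset_antisym) (simp_all flip: face_subset_iff)
  then show "bij_betw face (maxbicliques I J R) biclique_faces"
    by (simp add: bij_betw_def biclique_faces_def)
qed (simp add: face_subset_iff maxbiclique_le_def)

lemma biclique_faces_sub: "biclique_faces \<subseteq> faces P"
  using face_face_of by (auto simp: biclique_faces_def)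

lemma card_flag_biclique_faces:
  assumes "is_flag biclique_faces (\<subseteq>) C"
  shows "card C = Suc (dim V + 1)"
proof (rule card_flag_if_poset_rank)
  show "finite biclique_faces" "biclique_faces \<noteq> {}"
    using maxbicliques_nonempty by (auto simp: biclique_faces_def)
  show "graded biclique_faces (\<subseteq>)"
    using order_iso.graded_iff[OF order_iso_face] gr by simp
  show "poset_rank biclique_faces (\<subseteq>) = dim V + 1"
    using order_iso.poset_rank_eq[OF order_iso_face] rk by simp
qed (fact assms)

text \<open>A flag of maxbicliques gives \<open>dim V + 2\<close> faces of strictly increasing dimension at most \<open>dim V\<close>.\<close>

lemma aff_dim: "aff_dim P = int (dim V)"
proof (rule antisym)
  show "aff_dim P \<le> int (dim V)"
    using aff_dim_subset[OF P_sub] V by (simp add: aff_dim_subspace)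
  interpret ranked_poset "faces P" face_rank "face_rank P"
    using ranked_faces[OF polytope] .
  obtain C where C: "is_flag biclique_faces (\<subseteq>) C"
    using chain_imp_flag[of biclique_faces "(\<subseteq>)" "{}"] by (auto simp: chain_iff biclique_faces_def)
  then have "pred_on.chain (faces P) (\<subseteq>) C"
    using biclique_faces_sub by (auto simp: is_flag_iff chain_iff)
  then have "dim V + 1 \<le> face_rank P"
    using card_chain_le[of C] card_flag_biclique_faces[OF C] by simp
  then show "int (dim V) \<le> aff_dim P"
    using int_face_rank[of P] by linarith
qed

lemma biclique_faces_eq: "biclique_faces = faces P"
proof (rule subposet_of_faces_eq[OF polytope biclique_faces_sub])
  have "face_rank P = dim V + 1"
    using int_face_rank[of P] aff_dim by linarith
  then show "card C = Suc (face_rank P)" if "is_flag biclique_faces (\<subseteq>) C" for C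
    using card_flag_biclique_faces[OF that] by simp
  show "diamond biclique_faces (\<subseteq>)"
    using order_iso.diamond_target[OF order_iso_face dia] .
qed

lemma affine_hull: "affine hull P = V"
proof (rule affine_dim_equal)
  show "affine hull P \<subseteq> V"
    using P_sub V by (intro hull_minimal subspace_imp_affine)
  show "aff_dim (affine hull P) = aff_dim V"
    using aff_dim V by (simp add: aff_dim_subspace aff_dim_affine_hull)
  have "aff_dim P \<noteq> -1"
    using aff_dim by simp
  then show "affine hull P \<noteq> {}"
    by auto
qed (use V in \<open>auto intro: subspace_imp_affine\<close>)

text \<open>Otherwise \<open>h i\<close> would be constantly 1 on the affine hull \<open>V\<close>,
  which contains 0.\<close>

lemma F_neq: "i \<in> I \<Longrightarrow> F i \<noteq> P"
proof
  assume "F i = P"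
  then have "P \<subseteq> {x. h i \<bullet> x = 1}"
    by (auto simp: F_def)
  then have "affine hull P \<subseteq> {x. h i \<bullet> x = 1}"
    by (intro hull_minimal affine_hyperplane)
  then have "0 \<in> {x. h i \<bullet> x = 1}"
    using affine_hull V subspace_0 by blast
  then show False by simp
qed

lemma F_subset_imp_eq: "i \<in> I \<Longrightarrow> k \<in> I \<Longrightarrow> F i \<subseteq> F k \<Longrightarrow> i = k"
proof -
  assume ik: "i \<in> I" "k \<in> I" and sub: "F i \<subseteq> F k"
  have "R `` {i} \<subseteq> R `` {k}"
  proof
    fix j assume "j \<in> R `` {i}"
    then have "j \<in> J" "(i, j) \<in> R"
      using R by auto
    then have "w j \<in> F k"
      using w_in_F[of i j] ik sub by blast
    then show "j \<in> R `` {k}"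
      using w_in_F[of k j] ik \<open>j \<in> J\<close> by blast
  qed
  then show "i = k"
    using irred ik by (simp add: irredundant_def)
qed

text \<open>Every facet is an intersection of some \<open>F i\<close>, at least one since it is
  proper, and equals this \<open>F i\<close> by dimension. Conversely \<open>F i\<close> lies in a
  facet \<open>F k\<close>, and irredundance of the rows gives \<open>i = k\<close>.\<close>

lemma facets_P: "facets P = F ` I"
proof -
  have 1: "\<exists>i\<in>I. X = F i" if X: "X \<in> facets P" for X
  proof -
    have "X \<in> biclique_faces"
      using face_of_facet[OF X] biclique_faces_eq by simp
    then obtain B where B: "B \<in> maxbicliques I J R" "X = face B"
      by (auto simp: biclique_faces_def)
    have "fst B \<noteq> {}"
      using B(2) facet_neq[OF X] by (auto simp: face_def)
    then obtain i where i: "i \<in> fst B" "i \<in> I"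
      using maxbiclique_sub(1)[OF B(1)] by blast
    have sub: "X \<subseteq> F i"
      using B(2) i(1) by (auto simp: face_def)
    have "aff_dim (F i) < aff_dim P"
      using face_of_aff_dim_lt[OF polytope_imp_convex[OF polytope] F_face F_neq] i(2) by blast
    then have "\<not> X \<subset> F i"
      using aff_dim_face_psubset[OF face_of_facet[OF X] F_face[OF i(2)]] aff_dim_facet[OF X] by auto
    then show ?thesis
      using sub i(2) by blast
  qed
  have 2: "F i \<in> facets P" if i: "i \<in> I" for i
  proof -
    obtain X where X: "X \<in> facets P" "F i \<subseteq> X"
      using proper_face_subset_facet[OF polytope F_face[OF i] F_neq[OF i]] by blast
    then obtain k where "k \<in> I" "X = F k"
      using 1 by blast
    then show ?thesis
      using F_subset_imp_eq[OF i] X by blast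
  qed
  from 1 2 show ?thesis by blast
qed

lemma bij_F: "bij_betw F I (facets P)"
  unfolding bij_betw_def facets_P by (auto intro!: inj_onI F_subset_imp_eq)

text \<open>By irredundance of the columns, the face of the maxbiclique generated by
  \<open>j\<close> contains \<open>w k\<close> only for \<open>k = j\<close>. As a face of a hull it
  is the hull of such points, hence \<open>{w j}\<close>.\<close>

lemma w_extreme: "j \<in> J \<Longrightarrow> w j extreme_point_of P"
proof -
  assume j: "j \<in> J"
  define B where "B = (R\<inverse> `` {j} \<inter> I, {k \<in> J. R\<inverse> `` {j} \<inter> I \<subseteq> R\<inverse> `` {k}})"
  have B: "B \<in> maxbicliques I J R"
    unfolding B_def using maxbiclique_of_column[OF j] .
  have "k = j" if "k \<in> J" "R\<inverse> `` {j} \<inter> I \<subseteq> R\<inverse> `` {k}" for k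
  proof -
    have "R\<inverse> `` {j} \<subseteq> R\<inverse> `` {k}"
      using that R by blast
    then show ?thesis
      using irred j that(1) unfolding irredundant_def by blast
  qed
  then have sB: "snd B = {j}"
    using j by (auto simp: B_def)
  have face: "face B face_of convex hull (w ` J)"
    using face_face_of[OF B] by (simp add: P_def)
  obtain S where S: "S \<subseteq> w ` J" "face B = convex hull S"
    using face_of_convex_hull_subset[OF finite_imp_compact face] by auto
  have "S \<subseteq> {w j}"
  proof
    fix x assume "x \<in> S"
    then have "x \<in> w ` J" "x \<in> face B"
      using S by (auto intro: hull_inc)
    then obtain k where k: "k \<in> J" "x = w k" "w k \<in> face B"
      by blast
    then show "x \<in> {w j}"
      using w_in_face[OF B k(1)] sB by simp
  qed
  moreover have "w j \<in> face B"
    using w_in_face[OF B j] sB by simp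
  ultimately have "face B = {w j}"
    using S(2) by (metis convex_hull_empty convex_hull_singleton empty_iff subset_singletonD)
  then show ?thesis
    using face_face_of[OF B] by (simp add: face_of_singleton)
qed

lemma bij_w: "bij_betw w J (vertices P)"
proof -
  have "vertices P = w ` J"
    using w_extreme extreme_points_of_convex_hull[of "w ` J"] by (auto simp: vertices_def P_def)
  moreover have "inj_on w J"
  proof (rule inj_onI)
    fix j k assume jk: "j \<in> J" "k \<in> J" "w j = w k"
    have "(i, j) \<in> R \<longleftrightarrow> (i, k) \<in> R" for i
      using w_in_F[of i j] w_in_F[of i k] jk R by auto
    then have "R\<inverse> `` {j} \<subseteq> R\<inverse> `` {k}"
      by blast
    then show "j = k"
      using irred jk by (simp add: irredundant_def)
  qed
  ultimately show ?thesis
    by (simp add: bij_betw_def)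
qed

lemma type: "(P, F, w) \<in> type_polytopes I J R"
  using polytope bij_F bij_w w_in_F by (simp add: type_polytopes_def)

text \<open>
  A segment from an interior point \<open>p\<close> to \<open>0\<close> cannot leave \<open>P\<close> through \<open>F i\<close>, since \<open>h i\<close> is
  at most 1 at \<open>p\<close> and vanishes at \<open>0\<close>.
\<close>

lemma zero_in_rel_interior: "0 \<in> rel_interior P"
proof -
  have "P \<noteq> {}"
    using affine_hull V subspace_0 by fastforce
  then obtain p where p: "p \<in> rel_interior P"
    using rel_interior_eq_empty[OF polytope_imp_convex[OF polytope]] by blast
  have pP: "p \<in> P"
    using p rel_interior_subset by blast
  show ?thesis
  proof (cases "p = 0")
    case False
    have "p + - p \<in> affine hull P"
      using affine_hull V subspace_0 by simp
    then obtain t where t: "0 < t" "p + t *\<^sub>R (- p) \<in> rel_frontier P"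
        "\<And>e. 0 \<le> e \<Longrightarrow> e < t \<Longrightarrow> p + e *\<^sub>R (- p) \<in> rel_interior P"
      using ray_to_rel_frontier[OF polytope_imp_bounded[OF polytope] p, of "- p"] False
      by (metis neg_equal_0_iff_equal)
    \<comment> \<open>The origin has parameter 1 on this ray, so the ray must leave \<open>P\<close>
      later.\<close>
    have "t > 1"
    proof (rule ccontr)
      assume "\<not> t > 1"
      obtain G where G: "G facet_of P" "p + t *\<^sub>R (- p) \<in> G"
        using rel_frontier_of_polyhedron[OF polytope_imp_polyhedron[OF polytope]] t(2) by blast
      then have "G \<in> facets P"
        by (auto simp: facets_def facet_of_def)
      then obtain i where i: "i \<in> I" "G = F i"
        using facets_P by blast
      then have "h i \<bullet> (p + t *\<^sub>R (- p)) = 1"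
        using G(2) by (simp add: F_def)
      then have "(1 - t) * (h i \<bullet> p) = 1"
        by (simp add: inner_diff_right algebra_simps)
      moreover have "(1 - t) * (h i \<bullet> p) \<le> (1 - t) * 1"
        using h_le[OF i(1) pP] \<open>\<not> t > 1\<close> by (intro mult_left_mono) auto
      ultimately show False
        using t(1) by simp
    qed
    then show ?thesis
      using t(3)[of 1] by simp
  qed (use p in simp)
qed

lemma centered: "centered V P"
  using polytope affine_hull zero_in_rel_interior by (simp add: centered_def)

lemma centered_type: "(P, F, w) \<in> centered_type_polytopes V I J R"
  using type centered by (simp add: centered_type_polytopes_def)

lemma matrix_nth:
  assumes "i \<in> I" "j \<in> J"
  shows "facet_vertex_matrix V I J (P, F, w) $ i $ j = h i \<bullet> w j"
proof -
  interpret centered_polytope V P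
    using V centered by unfold_locales
  have "covertex V P (F i) = h i"
    using assms(1) facets_P h_in h_le by (intro covertex_eqI) (auto simp: F_def)
  then show ?thesis
    using assms by (simp add: facet_vertex_matrix_def)
qed

end

text \<open>Identify \<open>V\<close> with the column space, which has the same dimension:
  \<open>w j\<close> is the preimage of column \<open>j\<close>, and \<open>h i\<close> represents
  the coordinate \<open>i\<close>.\<close>

lemma rank_factorization:
  fixes M :: "real ^ 'j::finite ^ 'i::finite" and V :: "'a::euclidean_space set"
  assumes V: "subspace V" "dim V = rank M"
  obtains h w where "\<And>i. h i \<in> V" "\<And>j. w j \<in> V" "\<And>i j. h i \<bullet> w j = M $ i $ j"
proof -
  have "dim V = dim (span (columns M))"
    using assms(2) by (simp add: column_rank_def)
  then obtain f g where f: "linear f" "f ` V = span (columns M)"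
    using isometries_subspaces[OF V(1) subspace_span] by metis
  have "\<exists>x\<in>V. f x = column j M" for j
  proof -
    have "column j M \<in> f ` V"
      unfolding f(2) by (rule span_base) (auto simp: columns_def)
    then show ?thesis by force
  qed
  then obtain w where w: "\<And>j. w j \<in> V" "\<And>j. f (w j) = column j M"
    by metis
  have "\<exists>y\<in>V. \<forall>x\<in>V. y \<bullet> x = f x $ i" for i
  proof -
    have "linear (\<lambda>x. f x $ i)"
      using f(1) by (auto intro!: linearI simp: linear_add linear_cmul)
    then obtain y where "y \<in> V" "\<And>x. x \<in> V \<Longrightarrow> y \<bullet> x = f x $ i"
      using linear_functional_on_subspace[OF _ V(1), of "\<lambda>x. f x $ i"] by auto
    then show ?thesis by blast
  qed
  then obtain h where h: "\<And>i. h i \<in> V" "\<And>i x. x \<in> V \<Longrightarrow> h i \<bullet> x = f x $ i"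
    by metis
  have "h i \<bullet> w j = M $ i $ j" for i j
    using h(2)[OF w(1)] w(2) by (simp add: column_def)
  with that h(1) w(1) show ?thesis by blast
qed

theorem filled_incidence_matrix_realizable:
  fixes I :: "'i::finite set" and J :: "'j::finite set" and V :: "'a::euclidean_space set"
  assumes R: "R \<subseteq> I \<times> J" and V: "subspace V" "rank M = dim V" and M: "filled_incidence_matrix 1 I J R M"
    and "irredundant I J R" "graded (maxbicliques I J R) maxbiclique_le"
    and "poset_rank (maxbicliques I J R) maxbiclique_le = dim V + 1"
    and "diamond (maxbicliques I J R) maxbiclique_le"
  obtains Q where "Q \<in> centered_type_polytopes V I J R" "facet_vertex_matrix V I J Q = M"
proof -
  obtain h w where hw: "\<And>i. h i \<in> V" "\<And>j. w j \<in> V" "\<And>i j. h i \<bullet> w j = M $ i $ j"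
    using rank_factorization[OF V(1), of M] V(2) by metis
  interpret realization I J R V h w
  proof
    fix i j assume "i \<in> I" "j \<in> J"
    then show "(i, j) \<in> R \<Longrightarrow> h i \<bullet> w j = 1" "(i, j) \<notin> R \<Longrightarrow> h i \<bullet> w j < 1"
      using M hw(3) by (auto simp: filled_incidence_matrix_def)
  qed (use assms hw in blast)+
  have "facet_vertex_matrix V I J (P, F, w) $ i $ j = M $ i $ j" for i j
  proof (cases "i \<in> I \<and> j \<in> J")
    case True
    then show ?thesis
      using matrix_nth hw(3) by simp
  next
    case False
    then show ?thesis
      using M by (auto simp: filled_incidence_matrix_def matrices_def facet_vertex_matrix_def)
  qed
  then have "facet_vertex_matrix V I J (P, F, w) = M"
    by (simp add: vec_eq_iff)
  with that centered_type show ?thesis by blast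
qed


section \<open>Realizability and the linear moduli space\<close>

lemma facets_translation: "facets ((+) a ` P) = (`) ((+) a) ` facets P"
proof -
  have "X \<in> (`) ((+) a) ` facets P" if X: "X \<in> facets ((+) a ` P)" for X
  proof -
    have eq: "X = (+) a ` ((+) (- a) ` X)"
      by (simp add: image_image)
    then have "(+) (- a) ` X face_of P"
      using face_of_facet[OF X] face_of_translation_eq by metis
    moreover have "aff_dim ((+) (- a) ` X) = aff_dim P - 1"
      using aff_dim_facet[OF X] aff_dim_translation_eq[of a P] aff_dim_translation_eq[of "- a" X]
      by simp
    ultimately show ?thesis
      using eq by (auto simp: facets_def)
  qed
  then show ?thesis
    by (auto simp: facets_def aff_dim_translation_eq)
qed

lemma type_polytopes_translation:
  assumes "(P, F, w) \<in> type_polytopes I J R"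
  shows "((+) a ` P, \<lambda>i. (+) a ` F i, \<lambda>j. a + w j) \<in> type_polytopes I J R"
proof -
  have "bij_betw F I (facets P)" "bij_betw w J (vertices P)"
    using assms by (auto simp: type_polytopes_def)
  moreover have "bij_betw ((`) ((+) a)) (facets P) (facets ((+) a ` P))"
    unfolding facets_translation bij_betw_def
    by (simp add: inj_on_def inj_image_eq_iff)
  moreover have "bij_betw ((+) a) (vertices P) (vertices ((+) a ` P))"
    unfolding vertices_def extreme_points_of_translation bij_betw_def by simp
  ultimately have "bij_betw ((`) ((+) a) \<circ> F) I (facets ((+) a ` P))"
    "bij_betw ((+) a \<circ> w) J (vertices ((+) a ` P))"
    by (auto intro: bij_betw_trans)
  then show ?thesis
    using assms by (auto simp: type_polytopes_def polytope_translation_eq comp_def)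
qed

lemma centered_type_polytope_iff:
  fixes I :: "'i::finite set" and J :: "'j::finite set"
  assumes "R \<subseteq> I \<times> J" "subspace V"
  shows "(P, F, w) \<in> centered_type_polytopes V I J R \<longleftrightarrow> centered_type_polytope I J R P F w V"
  using assms
  by (auto simp: centered_type_polytopes_def centered_type_polytope_def type_polytope_def
      centered_polytope_def)

text \<open>The given polytope need not contain the origin, so a relative interior point is moved to
  0; the affine hull of the translate then serves as \<open>V\<close>.\<close>

lemma type_polytope_has_filled_matrix:
  fixes I :: "'i::finite set" and J :: "'j::finite set"
  assumes R: "R \<subseteq> I \<times> J" and type: "(P, F, w) \<in> type_polytopes I J R" and dim: "aff_dim P = int d"
  obtains M where "filled_incidence_matrix 1 I J R M" "rank M = d"
proof -
  have "polytope P"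
    using type by (simp add: type_polytopes_def)
  moreover have "P \<noteq> {}"
    using dim by auto
  ultimately obtain c where c: "c \<in> rel_interior P"
    using rel_interior_eq_empty polytope_imp_convex by blast
  define V where "V = affine hull ((+) (- c) ` P)"
  have "0 \<in> rel_interior ((+) (- c) ` P)"
    using imageI[OF c, of "(+) (- c)"] by (metis rel_interior_translation ab_left_minus)
  then have cent: "centered V ((+) (- c) ` P)"
    using \<open>polytope P\<close> polytope_translation_eq[of "- c" P] unfolding centered_def V_def by blast
  have "0 \<in> V"
    unfolding V_def using subsetD[OF rel_interior_subset \<open>0 \<in> rel_interior _\<close>] by (rule hull_inc)
  then have V: "subspace V"
    by (simp add: V_def subspace_affine)
  then interpret centered_type_polytope I J R "(+) (- c) ` P" "\<lambda>i. (+) (- c) ` F i" "\<lambda>j. - c + w j" V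
    using R cent type_polytopes_translation[OF type, of "- c"]
    by (simp add: centered_type_polytope_def type_polytope_def centered_polytope_def)
  have "rank matrix = d"
    using rank_matrix aff_dim dim aff_dim_translation_eq[of "- c" P] by simp
  with that matrix_filled show ?thesis by blast
qed

theorem realizable_iff:
  fixes I :: "'i::finite set" and J :: "'j::finite set" and R :: "('i \<times> 'j) set"
    and V :: "'a::euclidean_space set"
  assumes R: "R \<subseteq> I \<times> J" and V: "subspace V" "dim V = d"
  shows "(\<exists>(P :: 'a set, F, w) \<in> type_polytopes I J R. aff_dim P = int d) \<longleftrightarrow>
    irredundant I J R \<and>
    flag_connected (maxbicliques I J R) maxbiclique_le \<and>
    poset_rank (maxbicliques I J R) maxbiclique_le = d + 1 \<and>
    diamond (maxbicliques I J R) maxbiclique_le \<and>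
    (\<exists>M. filled_incidence_matrix 1 I J R M \<and> rank M = d)"
  (is "?l \<longleftrightarrow> ?r")
proof
  assume ?l
  then obtain P :: "'a set" and F w where PFw: "(P, F, w) \<in> type_polytopes I J R" "aff_dim P = int d"
    by auto
  interpret type_polytope I J R P F w
    using PFw R by unfold_locales
  have "face_rank P = d + 1"
    using PFw(2) by (simp add: face_rank_def)
  then show ?r
    using irredundant flag_connected poset_rank diamond type_polytope_has_filled_matrix[OF R PFw]
    by metis
next
  assume r: ?r
  then obtain M where M: "filled_incidence_matrix 1 I J R M" "rank M = d" by blast
  obtain Q where Q: "Q \<in> centered_type_polytopes V I J R"
    using filled_incidence_matrix_realizable[OF R V(1) _ M(1)] M(2) V(2) r
    unfolding flag_connected_def by metis
  obtain P F w where Q': "Q = (P, F, w)"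
    by (cases Q)
  then interpret centered_type_polytope I J R P F w V
    using Q centered_type_polytope_iff[OF R V(1)] by simp
  show ?l
    using type aff_dim assms(3) by auto
qed

text \<open>A single realization supplies the lattice conditions, and these allow every filled
  matrix of rank \<open>d\<close> to be realized.\<close>

theorem facet_vertex_matrix_iff:
  fixes I :: "'i::finite set" and J :: "'j::finite set" and R :: "('i \<times> 'j) set"
    and V :: "'a::euclidean_space set"
  assumes R: "R \<subseteq> I \<times> J" and V: "subspace V" "dim V = d"
    and real: "\<exists>(P :: 'a set, F, w) \<in> type_polytopes I J R. aff_dim P = int d"
  shows "(\<exists>Q \<in> centered_type_polytopes V I J R. facet_vertex_matrix V I J Q = M) \<longleftrightarrow>
    filled_incidence_matrix 1 I J R M \<and> rank M = d"
proof
  assume "\<exists>Q \<in> centered_type_polytopes V I J R. facet_vertex_matrix V I J Q = M"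
  then obtain P F w where Q: "(P, F, w) \<in> centered_type_polytopes V I J R"
    and M: "facet_vertex_matrix V I J (P, F, w) = M"
    by auto
  interpret centered_type_polytope I J R P F w V
    using Q centered_type_polytope_iff[OF R V(1)] by simp
  show "filled_incidence_matrix 1 I J R M \<and> rank M = d"
    using matrix_filled rank_matrix M assms(3) by simp
next
  assume "filled_incidence_matrix 1 I J R M \<and> rank M = d"
  then show "\<exists>Q \<in> centered_type_polytopes V I J R. facet_vertex_matrix V I J Q = M"
    using filled_incidence_matrix_realizable[OF R V(1), of M] V(2) real
    unfolding realizable_iff[OF R V] flag_connected_def by metis
qed

theorem same_matrix_iff:
  fixes I :: "'i::finite set" and J :: "'j::finite set" and R :: "('i \<times> 'j) set"
    and V :: "'a::euclidean_space set"
  assumes R: "R \<subseteq> I \<times> J" and V: "subspace V"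
    and Q: "Q \<in> centered_type_polytopes V I J R" "Q' \<in> centered_type_polytopes V I J R"
  shows "facet_vertex_matrix V I J Q = facet_vertex_matrix V I J Q' \<longleftrightarrow> linearly_equivalent V I J Q Q'"
proof -
  obtain P F w P' F' w' where eq: "Q = (P, F, w)" "Q' = (P', F', w')"
    by (metis prod_cases3)
  have "centered_type_polytope I J R P F w V" "centered_type_polytope I J R P' F' w' V"
    using Q centered_type_polytope_iff[OF R V] unfolding eq by blast+
  then show ?thesis
    unfolding eq
    using same_matrix_imp_linearly_equivalent linearly_equivalent_imp_same_matrix by blast
qed

text \<open>The quotient by the kernel of \<open>f\<close> is the image of \<open>f\<close>; with
  \<open>f\<close> the matrix map this parameterizes the moduli space.\<close>

lemma bij_betw_quotient:
  assumes "r = {(x, y). x \<in> A \<and> y \<in> A \<and> f x = f y}"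
  shows "\<exists>\<Phi>. bij_betw \<Phi> (A // r) (f ` A) \<and> (\<forall>x\<in>A. \<Phi> (r `` {x}) = f x)"
proof -
  \<comment> \<open>The choice of the representative is harmless because \<open>f\<close> is
    constant on each class.\<close>
  define \<Phi> where "\<Phi> X = f (SOME x. x \<in> X)" for X
  have \<Phi>: "\<Phi> (r `` {x}) = f x" if "x \<in> A" for x
  proof -
    have "x \<in> r `` {x}"
      using that assms by simp
    then have "(SOME y. y \<in> r `` {x}) \<in> r `` {x}"
      by (rule someI)
    then have "(x, SOME y. y \<in> r `` {x}) \<in> r"
      by simp
    then show ?thesis
      unfolding \<Phi>_def by (subst (asm) (1) assms) simp
  qed
  have "inj_on \<Phi> (A // r)"
  proof (rule inj_onI)
    fix X Y assume "X \<in> A // r" "Y \<in> A // r" and eq: "\<Phi> X = \<Phi> Y"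
    then obtain x y where xy: "x \<in> A" "y \<in> A" "X = r `` {x}" "Y = r `` {y}"
      by (auto simp: quotient_def)
    then have "f x = f y"
      using eq \<Phi> by simp
    then show "X = Y"
      using xy assms by auto
  qed
  moreover have "\<Phi> ` (A // r) = f ` A"
  proof -
    have "A // r = (\<lambda>x. r `` {x}) ` A"
      by (auto simp: quotient_def)
    then show ?thesis
      using \<Phi> by (simp add: image_image cong: image_cong)
  qed
  ultimately show ?thesis
    using \<Phi> unfolding bij_betw_def by blast
qed

theorem theorem1:
  fixes I :: "'i::finite set" and J :: "'j::finite set" and R :: "('i \<times> 'j) set"
    and d :: nat and V :: "'a::euclidean_space set"
  assumes "R \<subseteq> I \<times> J" and "subspace V" and "dim V = d"
  defines "realizable \<equiv>
    (\<exists>(P :: 'a set, F, w) \<in> type_polytopes I J R. aff_dim P = int d)"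
  shows
    "(realizable \<longleftrightarrow>
        irredundant I J R \<and>
        flag_connected (maxbicliques I J R) maxbiclique_le \<and>
        poset_rank (maxbicliques I J R) maxbiclique_le = d + 1 \<and>
        diamond (maxbicliques I J R) maxbiclique_le \<and>
        (\<exists>M. filled_incidence_matrix 1 I J R M \<and> rank M = d)) \<and>
     (realizable \<longrightarrow>
        (\<forall>M \<in> matrices I J.
           (\<exists>Q \<in> centered_type_polytopes V I J R. facet_vertex_matrix V I J Q = M) \<longleftrightarrow>
           filled_incidence_matrix 1 I J R M \<and> rank M = d) \<and>
        (\<forall>Q \<in> centered_type_polytopes V I J R. \<forall>Q' \<in> centered_type_polytopes V I J R.
           facet_vertex_matrix V I J Q = facet_vertex_matrix V I J Q' \<longleftrightarrow>
           linearly_equivalent V I J Q Q') \<and>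
        equiv (centered_type_polytopes V I J R) (linear_equivalence V I J R) \<and>
        (\<exists>\<Phi>. bij_betw \<Phi> (linear_moduli_space V I J R)
                 {M. filled_incidence_matrix 1 I J R M \<and> rank M = d} \<and>
              (\<forall>Q \<in> centered_type_polytopes V I J R.
                 \<Phi> (linear_equivalence V I J R `` {Q}) = facet_vertex_matrix V I J Q)))"
proof (intro conjI impI ballI)
  show "realizable \<longleftrightarrow>
        irredundant I J R \<and>
        flag_connected (maxbicliques I J R) maxbiclique_le \<and>
        poset_rank (maxbicliques I J R) maxbiclique_le = d + 1 \<and>
        diamond (maxbicliques I J R) maxbiclique_le \<and>
        (\<exists>M. filled_incidence_matrix 1 I J R M \<and> rank M = d)"
    unfolding realizable_def by (rule realizable_iff) fact+
next
  fix M assume realizable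
  then show "(\<exists>Q \<in> centered_type_polytopes V I J R. facet_vertex_matrix V I J Q = M) \<longleftrightarrow>
      filled_incidence_matrix 1 I J R M \<and> rank M = d"
    unfolding realizable_def using assms(1-3) by (intro facet_vertex_matrix_iff)
next
  fix Q Q' assume "Q \<in> centered_type_polytopes V I J R" "Q' \<in> centered_type_polytopes V I J R"
  then show "facet_vertex_matrix V I J Q = facet_vertex_matrix V I J Q' \<longleftrightarrow> linearly_equivalent V I J Q Q'"
    using same_matrix_iff assms(1,2) by blast
next
  let ?C = "centered_type_polytopes V I J R" and ?f = "facet_vertex_matrix V I J"
  assume real: realizable
  \<comment> \<open>Linear equivalence is the kernel of the matrix map, hence an equivalence
    relation.\<close>
  have eq: "linear_equivalence V I J R = {(Q, Q'). Q \<in> ?C \<and> Q' \<in> ?C \<and> ?f Q = ?f Q'}"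
    unfolding linear_equivalence_def using same_matrix_iff[OF assms(1,2)] by blast
  show "equiv ?C (linear_equivalence V I J R)"
    unfolding eq by (auto simp: equiv_def refl_on_def sym_def trans_def)
  have "?f ` ?C = {M. filled_incidence_matrix 1 I J R M \<and> rank M = d}"
    using facet_vertex_matrix_iff[OF assms(1-3) real[unfolded realizable_def]]
    unfolding image_def by metis
  then show "\<exists>\<Phi>. bij_betw \<Phi> (linear_moduli_space V I J R)
                 {M. filled_incidence_matrix 1 I J R M \<and> rank M = d} \<and>
              (\<forall>Q \<in> ?C. \<Phi> (linear_equivalence V I J R `` {Q}) = ?f Q)"
    using bij_betw_quotient[OF eq] by (simp add: linear_moduli_space_def)
qed

end
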